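(* Let $\tau'$ and $\tau$ be the scalar curvatures of the canonical connection $\nabla'$ and of the Levi-Civita connection $\nabla$, respectively, on a Riemannian almost product $\mathcal{W}_3$-manifold $(M,P,g)$. Then \[ \|\nabla P\|^2=8(\tau'-\tau). \]
   Context: A Riemannian almost product manifold $(M,P,g)$ is a differentiable manifold $M$ with a $(1,1)$-tensor field $P$ and a Riemannian metric $g$ such that $P^2x=x$ and $g(Px,Py)=g(x,y)$ for all vector fields $x,y$; throughout it is assumed that $\mathrm{tr}\,P=0$. Let $\nabla$ be the Levi-Civita connection of $g$ and $F(x,y,z)=g((\nabla_xP)y,z)$. $(M,P,g)$ is a Riemannian almost product $\mathcal{W}_3$-manifold if $F(x,y,z)+F(y,z,x)+F(z,x,y)=0$ for all $x,y,z$. A natural connection is a linear connection $\nabla'$ with $\nabla'P=0$ and $\nabla'g=0$; its torsion is $T(x,y)=\nabla'_xy-\nabla'_yx-[x,y]$, with $T(x,y,z)=g(T(x,y),z)$. The canonical connection is the natural connection whose torsion satisfies \[T(x,y,z)+T(y,z,x)+T(Px,y,Pz)+T(y,Pz,Px)=0\] for all $x,y,z$; it is known that it exists and is unique on every Riemannian almost product manifold. Curvature: $R(x,y)z=\nabla_x\nabla_yz-\nabla_y\nabla_xz-\nabla_{[x,y]}z$, $R(x,y,z,w)=g(R(x,y)z,w)$, and $R'$ is defined in the same way from $\nabla'$. For a basis $\{e_i\}$ of $T_pM$, with $g^{ij}$ the components of the inverse matrix of $g$, the Ricci tensor and scalar curvature are $\rho(y,z)=g^{ij}R(e_i,y,z,e_j)$,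 $\tau=g^{ij}\rho(e_i,e_j)$, and $\rho',\tau'$ are defined in the same way from $R'$ (summation convention). The square norm of $\nabla P$ is $\|\nabla P\|^2=g^{ij}g^{ks}g\bigl((\nabla_{e_i}P)e_k,(\nabla_{e_j}P)e_s\bigr)$. *)

theory Defs
  imports "HOL-Analysis.Analysis" "HOL-Library.Function_Algebras"
begin

text \<open>Sums, differences and products of functions are pointwise throughout
  (\<^theory>\<open>HOL-Library.Function_Algebras\<close>).\<close>


subsection \<open>Smooth manifolds\<close>

primrec k_smooth_on ::
  "nat \<Rightarrow> 'a::euclidean_space set \<Rightarrow> ('a \<Rightarrow> 'b::euclidean_space) \<Rightarrow> bool" where
  "k_smooth_on 0 S f = continuous_on S f"
| "k_smooth_on (Suc k) S f =
     ((\<forall>x\<in>S. f differentiable (at x)) \<and>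
      (\<forall>v. k_smooth_on k S (\<lambda>x. frechet_derivative f (at x) v)))"

text \<open>Used for open sets only.\<close>
definition smooth_on ::
  "'a::euclidean_space set \<Rightarrow> ('a \<Rightarrow> 'b::euclidean_space) \<Rightarrow> bool" where
  "smooth_on S f \<longleftrightarrow> (\<forall>k. k_smooth_on k S f)"

text \<open>The manifold is the whole type \<open>'m\<close>, its dimension is \<open>CARD('n)\<close>.\<close>
type_synonym ('m, 'n) atlas = "('m set \<times> ('m \<Rightarrow> real ^ 'n)) set"

definition smooth_manifold ::
  "('m::{t2_space, second_countable_topology}, 'n::finite) atlas \<Rightarrow> bool" where
  "smooth_manifold A \<longleftrightarrow>
     (\<Union>(U, \<phi>)\<in>A. U) = UNIV \<and>
     (\<forall>(U, \<phi>)\<in>A. open U \<and> open (\<phi> ` U) \<and> homeomorphism U (\<phi> ` U) \<phi> (inv_into U \<phi>)) \<and>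
     (\<forall>(U, \<phi>)\<in>A. \<forall>(V, \<psi>)\<in>A. smooth_on (\<phi> ` (U \<inter> V)) (\<psi> \<circ> inv_into U \<phi>))"

definition smooth_functions :: "('m, 'n::finite) atlas \<Rightarrow> ('m \<Rightarrow> real) set" where
  "smooth_functions A = {f. \<forall>(U, \<phi>)\<in>A. smooth_on (\<phi> ` U) (f \<circ> inv_into U \<phi>)}"

text \<open>Tangent vectors are the point derivations and vector fields are the derivations of the
  algebra of smooth functions.  They are set to 0 on nonsmooth functions, so that two of them
  are equal as soon as they agree on the smooth functions.\<close>

type_synonym 'm tvec = "('m \<Rightarrow> real) \<Rightarrow> real"
type_synonym 'm vfield = "('m \<Rightarrow> real) \<Rightarrow> ('m \<Rightarrow> real)"

definition tangent_space :: "('m, 'n::finite) atlas \<Rightarrow> 'm \<Rightarrow> 'm tvec set" where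
  "tangent_space A p = {v.
     (\<forall>f. f \<notin> smooth_functions A \<longrightarrow> v f = 0) \<and>
     (\<forall>f\<in>smooth_functions A. \<forall>c. v (\<lambda>q. c * f q) = c * v f) \<and>
     (\<forall>f\<in>smooth_functions A. \<forall>h\<in>smooth_functions A.
        v (f + h) = v f + v h \<and> v (f * h) = v f * h p + f p * v h)}"

definition vector_fields :: "('m, 'n::finite) atlas \<Rightarrow> 'm vfield set" where
  "vector_fields A = {X.
     (\<forall>f. f \<notin> smooth_functions A \<longrightarrow> X f = 0) \<and>
     (\<forall>f\<in>smooth_functions A. X f \<in> smooth_functions A) \<and>
     (\<forall>f\<in>smooth_functions A. \<forall>c. X (\<lambda>q. c * f q) = (\<lambda>q. c * X f q)) \<and>
     (\<forall>f\<in>smooth_functions A. \<forall>h\<in>smooth_functions A.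
        X (f + h) = X f + X h \<and> X (f * h) = X f * h + f * X h)}"

definition value_at :: "'m vfield \<Rightarrow> 'm \<Rightarrow> 'm tvec" where
  "value_at X p = (\<lambda>f. X f p)"

definition fscale :: "('m \<Rightarrow> real) \<Rightarrow> 'm vfield \<Rightarrow> 'm vfield" where
  "fscale f X = (\<lambda>h. f * X h)"

definition bracket :: "'m vfield \<Rightarrow> 'm vfield \<Rightarrow> 'm vfield" where
  "bracket X Y = (\<lambda>f. X (Y f) - Y (X f))"

text \<open>A basis of the tangent space at \<open>p\<close> is given by vector fields \<open>E i\<close> whose values at \<open>p\<close>
  form that basis.  Tensor fields are multilinear over the smooth functions, so their value at
  \<open>p\<close> on such fields depends only on the basis.\<close>
definition tangent_basis ::
  "('m, 'n::finite) atlas \<Rightarrow> 'm \<Rightarrow> ('n \<Rightarrow> 'm vfield) \<Rightarrow> bool" where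
  "tangent_basis A p E \<longleftrightarrow>
     (\<forall>i. E i \<in> vector_fields A) \<and>
     (\<forall>v\<in>tangent_space A p. \<exists>!c :: real ^ 'n. v = (\<lambda>f. \<Sum>i\<in>UNIV. c $ i * value_at (E i) p f))"

definition basis_at :: "('m, 'n::finite) atlas \<Rightarrow> 'm \<Rightarrow> 'n \<Rightarrow> 'm vfield" where
  "basis_at A p = (SOME E. tangent_basis A p E)"


subsection \<open>Riemannian almost product manifolds\<close>

definition tensor_field_1_1 ::
  "('m, 'n::finite) atlas \<Rightarrow> ('m vfield \<Rightarrow> 'm vfield) \<Rightarrow> bool" where
  "tensor_field_1_1 A P \<longleftrightarrow>
     (\<forall>X\<in>vector_fields A. P X \<in> vector_fields A) \<and>
     (\<forall>X\<in>vector_fields A. \<forall>Y\<in>vector_fields A. P (X + Y) = P X + P Y) \<and>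
     (\<forall>f\<in>smooth_functions A. \<forall>X\<in>vector_fields A. P (fscale f X) = fscale f (P X))"

text \<open>Linearity in the second argument follows from symmetry.\<close>
definition riemannian_metric ::
  "('m, 'n::finite) atlas \<Rightarrow> ('m vfield \<Rightarrow> 'm vfield \<Rightarrow> 'm \<Rightarrow> real) \<Rightarrow> bool" where
  "riemannian_metric A g \<longleftrightarrow>
     (\<forall>X\<in>vector_fields A. \<forall>Y\<in>vector_fields A. g X Y \<in> smooth_functions A \<and> g X Y = g Y X) \<and>
     (\<forall>X\<in>vector_fields A. \<forall>Y\<in>vector_fields A. \<forall>Z\<in>vector_fields A.
        g (X + Y) Z = g X Z + g Y Z) \<and>
     (\<forall>f\<in>smooth_functions A. \<forall>X\<in>vector_fields A. \<forall>Y\<in>vector_fields A.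
        g (fscale f X) Y = f * g X Y) \<and>
     (\<forall>X\<in>vector_fields A. \<forall>p. value_at X p \<noteq> 0 \<longrightarrow> g X X p > 0)"

definition matrix_at ::
  "('m, 'n::finite) atlas \<Rightarrow> ('m vfield \<Rightarrow> 'm vfield) \<Rightarrow> 'm \<Rightarrow> real ^ 'n ^ 'n" where
  "matrix_at A P p = (THE M. \<forall>j. value_at (P (basis_at A p j)) p =
     (\<lambda>f. \<Sum>i\<in>UNIV. M $ i $ j * value_at (basis_at A p i) p f))"

definition riemannian_almost_product ::
  "('m::{t2_space, second_countable_topology}, 'n::finite) atlas \<Rightarrow> ('m vfield \<Rightarrow> 'm vfield) \<Rightarrow>
   ('m vfield \<Rightarrow> 'm vfield \<Rightarrow> 'm \<Rightarrow> real) \<Rightarrow> bool" where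
  "riemannian_almost_product A P g \<longleftrightarrow>
     smooth_manifold A \<and> tensor_field_1_1 A P \<and> riemannian_metric A g \<and>
     (\<forall>X\<in>vector_fields A. P (P X) = X) \<and>
     (\<forall>X\<in>vector_fields A. \<forall>Y\<in>vector_fields A. g (P X) (P Y) = g X Y) \<and>
     (\<forall>p. trace (matrix_at A P p) = 0)"


subsection \<open>Linear connections\<close>

type_synonym 'm connection = "'m vfield \<Rightarrow> 'm vfield \<Rightarrow> 'm vfield"

definition linear_connection :: "('m, 'n::finite) atlas \<Rightarrow> 'm connection \<Rightarrow> bool" where
  "linear_connection A D \<longleftrightarrow>
     (\<forall>X\<in>vector_fields A. \<forall>Y\<in>vector_fields A. D X Y \<in> vector_fields A) \<and>
     (\<forall>X\<in>vector_fields A. \<forall>Y\<in>vector_fields A. \<forall>Z\<in>vector_fields A.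
        D (X + Y) Z = D X Z + D Y Z \<and> D X (Y + Z) = D X Y + D X Z) \<and>
     (\<forall>f\<in>smooth_functions A. \<forall>X\<in>vector_fields A. \<forall>Y\<in>vector_fields A.
        D (fscale f X) Y = fscale f (D X Y) \<and>
        D X (fscale f Y) = fscale (X f) Y + fscale f (D X Y))"

definition torsion :: "'m connection \<Rightarrow> 'm vfield \<Rightarrow> 'm vfield \<Rightarrow> 'm vfield" where
  "torsion D X Y = D X Y - D Y X - bracket X Y"

definition curvature :: "'m connection \<Rightarrow> 'm vfield \<Rightarrow> 'm vfield \<Rightarrow> 'm vfield \<Rightarrow> 'm vfield" where
  "curvature D X Y Z = D X (D Y Z) - D Y (D X Z) - D (bracket X Y) Z"

text \<open>\<open>deriv_P D P X Y\<close> is \<open>(D\<^sub>X P) Y\<close>.\<close>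
definition deriv_P ::
  "'m connection \<Rightarrow> ('m vfield \<Rightarrow> 'm vfield) \<Rightarrow> 'm vfield \<Rightarrow> 'm vfield \<Rightarrow> 'm vfield" where
  "deriv_P D P X Y = D X (P Y) - P (D X Y)"

text \<open>\<open>deriv_g D g X Y Z\<close> is \<open>(D\<^sub>X g)(Y, Z)\<close>.\<close>
definition deriv_g ::
  "'m connection \<Rightarrow> ('m vfield \<Rightarrow> 'm vfield \<Rightarrow> 'm \<Rightarrow> real) \<Rightarrow>
   'm vfield \<Rightarrow> 'm vfield \<Rightarrow> 'm vfield \<Rightarrow> 'm \<Rightarrow> real" where
  "deriv_g D g X Y Z = X (g Y Z) - g (D X Y) Z - g Y (D X Z)"

definition levi_civita ::
  "('m, 'n::finite) atlas \<Rightarrow> ('m vfield \<Rightarrow> 'm vfield \<Rightarrow> 'm \<Rightarrow> real) \<Rightarrow> 'm connection \<Rightarrow> bool" where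
  "levi_civita A g D \<longleftrightarrow>
     linear_connection A D \<and>
     (\<forall>X\<in>vector_fields A. \<forall>Y\<in>vector_fields A. torsion D X Y = 0) \<and>
     (\<forall>X\<in>vector_fields A. \<forall>Y\<in>vector_fields A. \<forall>Z\<in>vector_fields A. deriv_g D g X Y Z = 0)"

definition natural_connection ::
  "('m, 'n::finite) atlas \<Rightarrow> ('m vfield \<Rightarrow> 'm vfield) \<Rightarrow>
   ('m vfield \<Rightarrow> 'm vfield \<Rightarrow> 'm \<Rightarrow> real) \<Rightarrow> 'm connection \<Rightarrow> bool" where
  "natural_connection A P g D \<longleftrightarrow>
     linear_connection A D \<and>
     (\<forall>X\<in>vector_fields A. \<forall>Y\<in>vector_fields A. deriv_P D P X Y = 0) \<and>
     (\<forall>X\<in>vector_fields A. \<forall>Y\<in>vector_fields A. \<forall>Z\<in>vector_fields A. deriv_g D g X Y Z = 0)"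

definition canonical_connection ::
  "('m, 'n::finite) atlas \<Rightarrow> ('m vfield \<Rightarrow> 'm vfield) \<Rightarrow>
   ('m vfield \<Rightarrow> 'm vfield \<Rightarrow> 'm \<Rightarrow> real) \<Rightarrow> 'm connection \<Rightarrow> bool" where
  "canonical_connection A P g D \<longleftrightarrow>
     natural_connection A P g D \<and>
     (\<forall>X\<in>vector_fields A. \<forall>Y\<in>vector_fields A. \<forall>Z\<in>vector_fields A.
        g (torsion D X Y) Z + g (torsion D Y Z) X +
        g (torsion D (P X) Y) (P Z) + g (torsion D Y (P Z)) (P X) = 0)"

text \<open>The Levi-Civita connection exists and is unique as an operator on vector fields, so the
  quantifier over \<open>D\<close> only serves to name it.\<close>
definition W3_manifold ::
  "('m::{t2_space, second_countable_topology}, 'n::finite) atlas \<Rightarrow> ('m vfield \<Rightarrow> 'm vfield) \<Rightarrow>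
   ('m vfield \<Rightarrow> 'm vfield \<Rightarrow> 'm \<Rightarrow> real) \<Rightarrow> bool" where
  "W3_manifold A P g \<longleftrightarrow>
     riemannian_almost_product A P g \<and>
     (\<forall>D. levi_civita A g D \<longrightarrow>
       (\<forall>X\<in>vector_fields A. \<forall>Y\<in>vector_fields A. \<forall>Z\<in>vector_fields A.
          g (deriv_P D P X Y) Z + g (deriv_P D P Y Z) X + g (deriv_P D P Z X) Y = 0))"


subsection \<open>Contractions\<close>

definition inverse_gram ::
  "('m, 'n::finite) atlas \<Rightarrow> ('m vfield \<Rightarrow> 'm vfield \<Rightarrow> 'm \<Rightarrow> real) \<Rightarrow> 'm \<Rightarrow> real ^ 'n ^ 'n" where
  "inverse_gram A g p = matrix_inv (\<chi> i j. g (basis_at A p i) (basis_at A p j) p)"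

text \<open>\<open>g\<^sup>i\<^sup>j B(e\<^sub>i, e\<^sub>j)\<close>, as a function on the manifold.  For bilinear \<open>B\<close>
  the choice of basis does not matter.\<close>
definition contract ::
  "('m, 'n::finite) atlas \<Rightarrow> ('m vfield \<Rightarrow> 'm vfield \<Rightarrow> 'm \<Rightarrow> real) \<Rightarrow>
   ('m vfield \<Rightarrow> 'm vfield \<Rightarrow> 'm \<Rightarrow> real) \<Rightarrow> 'm \<Rightarrow> real" where
  "contract A g B = (\<lambda>p. \<Sum>i\<in>UNIV. \<Sum>j\<in>UNIV.
     inverse_gram A g p $ i $ j * B (basis_at A p i) (basis_at A p j) p)"

definition ricci ::
  "('m, 'n::finite) atlas \<Rightarrow> ('m vfield \<Rightarrow> 'm vfield \<Rightarrow> 'm \<Rightarrow> real) \<Rightarrow> 'm connection \<Rightarrow>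
   'm vfield \<Rightarrow> 'm vfield \<Rightarrow> 'm \<Rightarrow> real" where
  "ricci A g D Y Z = contract A g (\<lambda>X W. g (curvature D X Y Z) W)"

definition scalar_curvature ::
  "('m, 'n::finite) atlas \<Rightarrow> ('m vfield \<Rightarrow> 'm vfield \<Rightarrow> 'm \<Rightarrow> real) \<Rightarrow> 'm connection \<Rightarrow>
   'm \<Rightarrow> real" where
  "scalar_curvature A g D = contract A g (ricci A g D)"

definition square_norm_deriv_P ::
  "('m, 'n::finite) atlas \<Rightarrow> ('m vfield \<Rightarrow> 'm vfield \<Rightarrow> 'm \<Rightarrow> real) \<Rightarrow> 'm connection \<Rightarrow>
   ('m vfield \<Rightarrow> 'm vfield) \<Rightarrow> 'm \<Rightarrow> real" where
  "square_norm_deriv_P A g D P =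
     contract A g (\<lambda>X X'. contract A g (\<lambda>Y Y'. g (deriv_P D P X Y) (deriv_P D P X' Y')))"

end

theory Submission
  imports Defs
begin

text \<open>Write \<open>dP X Y = (D\<^sub>X P) Y\<close> and \<open>Q X Y = D'\<^sub>X Y - D\<^sub>X Y\<close>.  Both are tensors.  As \<open>P\<close> is self-adjoint with \<open>P\<^sup>2 = 1\<close>,
\<open>dP X\<close> is self-adjoint and anticommutes with \<open>P\<close>, and the cyclic identity of \<open>\<W>\<^sub>3\<close>-manifolds becomes
\<open>dP X Y + dP Y X = P (dP (P X) Y) + P (dP (P Y) X)\<close>;
that is, \<open>dP\<close> is skew in two arguments from the same eigenbundle of \<open>P\<close> (\<open>W3_sym\<close>).  The condition
on the torsion of the canonical connection is linear in \<open>Q\<close> and has only one natural solution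
(\<open>canonical_potential\<close>), namely
\<open>Q X Y = P (dP X Y) / 2 + (P (dP Y X) + dP (P Y) X) / 4\<close>.

The two curvatures differ by first derivatives of \<open>Q\<close> and by quadratic terms in \<open>Q\<close>.  The
formula for \<open>Q\<close> shows that \<open>Q (P X) (P Y) + Q (P Y) (P X) = - Q X Y - Q Y X\<close>.  As \<open>P\<close> is orthogonal and
parallel for \<open>D'\<close>, the tensors \<open>Q\<close> and \<open>D'\<^sub>X Q\<close> have trace zero in their two vector arguments.  This
kills the derivative terms of the scalar curvature and one of the quadratic ones.  What remains is
\<open>\<tau>' - \<tau> = \<Sum> g (Q e\<^sub>i e\<^sub>k) (Q e\<^sub>k e\<^sub>i)\<close> for an orthonormal basis
(\<open>scalar_curvature_difference\<close>).

Inserting the formula for \<open>Q\<close> gives a combination of full contractions of \<open>dP\<close> with itself.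
Some of them vanish (\<open>twisted_dP_zero\<close>), the others are \<open>\<parallel>dP\<parallel>\<^sup>2\<close> or, up to sign,
\<open>\<Sum> g (dP e\<^sub>i e\<^sub>k) (dP e\<^sub>k e\<^sub>i)\<close>, which equals \<open>-\<parallel>dP\<parallel>\<^sup>2/2\<close> (\<open>cross_dP_eq\<close>); the sum is
\<open>\<parallel>dP\<parallel>\<^sup>2/8\<close>.

The contractions are taken over a basis of the space of point derivations, so the argument needs that
\<open>CARD('n)\<close> vector fields with this property exist at every point and that a map which is linear
over the smooth functions acts pointwise.  Both follow from \<open>local_frame\<close>, which cuts
off coordinate fields by bump functions and uses Hadamard's lemma to express every point derivation
near \<open>p\<close> by partial derivatives.\<close>

section \<open>Calculus of smooth functions on open sets\<close>

lemma k_smooth_on_cong: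
  assumes "open S" "\<And>x. x \<in> S \<Longrightarrow> f x = g x" "k_smooth_on k S f"
  shows "k_smooth_on k S g"
  using assms(2,3)
proof (induction k arbitrary: f g)
  case 0
  then show ?case using continuous_on_cong by fastforce
next
  case (Suc k)
  have eq: "frechet_derivative f (at x) = frechet_derivative g (at x)" if "x \<in> S" for x
    using frechet_derivative_transform_within_open[OF _ assms(1) that, of f g] Suc.prems that
    by auto
  have "k_smooth_on k S (\<lambda>x. frechet_derivative g (at x) v)" for v
    by (rule Suc.IH[of "\<lambda>x. frechet_derivative f (at x) v"]) (use Suc.prems eq in auto)
  moreover have "g differentiable (at x)" if "x \<in> S" for x
  proof -
    have "(f has_derivative frechet_derivative f (at x)) (at x)"
      using Suc.prems that frechet_derivative_works by auto
    then have "(g has_derivative frechet_derivative f (at x)) (at x)"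
      using has_derivative_transform_within_open[OF _ assms(1) that] Suc.prems(1) by blast
    then show ?thesis unfolding differentiable_def by blast
  qed
  ultimately show ?case by simp
qed

lemma k_smooth_on_subset:
  "k_smooth_on k S f \<Longrightarrow> T \<subseteq> S \<Longrightarrow> k_smooth_on k T f"
  by (induction k arbitrary: f) (auto intro: continuous_on_subset)

lemma k_smooth_on_Suc_imp:
  "k_smooth_on (Suc k) S f \<Longrightarrow> k_smooth_on k S f"
proof (induction k arbitrary: f)
  case 0
  then show ?case
    by (auto intro!: continuous_at_imp_continuous_on differentiable_imp_continuous_within)
next
  case (Suc k)
  then show ?case using k_smooth_on.simps(2) by blast
qed

lemma k_smooth_on_continuous: "k_smooth_on k S f \<Longrightarrow> continuous_on S f"
proof (induction k)
  case (Suc k)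
  then show ?case using k_smooth_on_Suc_imp by blast
qed simp

lemma linear_sum_Basis:
  fixes L :: "'a::euclidean_space \<Rightarrow> real"
  assumes "linear L"
  shows "L v = (\<Sum>b\<in>Basis. (v \<bullet> b) * L b)"
proof -
  have "L (\<Sum>b\<in>Basis. (v \<bullet> b) *\<^sub>R b) = (\<Sum>b\<in>Basis. (v \<bullet> b) * L b)"
    by (simp add: linear_sum[OF assms] linear_cmul[OF assms])
  then show ?thesis by (simp add: euclidean_representation)
qed

lemma k_smooth_on_Un:
  assumes "open S" "open T"
  shows "k_smooth_on k S f \<Longrightarrow> k_smooth_on k T f \<Longrightarrow> k_smooth_on k (S \<union> T) f"
  using assms by (induction k arbitrary: f) (auto intro: continuous_on_open_Un)

lemma k_smooth_on_const: "k_smooth_on k S (\<lambda>x. c)"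
  by (induction k arbitrary: c) (auto simp: frechet_derivative_const)

lemma k_smooth_on_SucI:
  assumes "open S" "\<And>x. x \<in> S \<Longrightarrow> (f has_derivative f' x) (at x)"
    and "\<And>v. k_smooth_on k S (\<lambda>x. f' x v)"
  shows "k_smooth_on (Suc k) S f"
proof -
  have "frechet_derivative f (at x) = f' x" if "x \<in> S" for x
    using assms(2)[OF that] frechet_derivative_at by metis
  then have "k_smooth_on k S (\<lambda>x. frechet_derivative f (at x) v)" for v
    using k_smooth_on_cong[OF assms(1) _ assms(3)[of v], of "\<lambda>x. frechet_derivative f (at x) v"] by auto
  then show ?thesis using assms(2) by (auto simp: differentiable_def)
qed

lemma k_smooth_on_SucD:
  assumes "k_smooth_on (Suc k) S f" "x \<in> S"
  shows "(f has_derivative frechet_derivative f (at x)) (at x)"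
  using assms frechet_derivative_works by auto

lemma k_smooth_on_bounded_linear_comp:
  assumes "open S" "bounded_linear h"
  shows "k_smooth_on k S f \<Longrightarrow> k_smooth_on k S (\<lambda>x. h (f x))"
proof (induction k arbitrary: f)
  case 0
  then show ?case using assms(2) by (auto intro: bounded_linear.continuous_on)
next
  case (Suc k)
  show ?case
  proof (rule k_smooth_on_SucI[OF assms(1)])
    show "((\<lambda>x. h (f x)) has_derivative (\<lambda>v. h (frechet_derivative f (at x) v))) (at x)" if "x \<in> S" for x
      by (rule bounded_linear.has_derivative[OF assms(2) k_smooth_on_SucD[OF Suc.prems that]])
    show "k_smooth_on k S (\<lambda>x. h (frechet_derivative f (at x) v))" for v
      using Suc by auto
  qed
qed

lemma k_smooth_on_ident: "open S \<Longrightarrow> k_smooth_on k S (\<lambda>x. x)"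
proof (cases k)
  case (Suc l)
  assume "open S"
  then show ?thesis unfolding Suc
    by (intro k_smooth_on_SucI[where f' = "\<lambda>_ v. v"]) (auto intro: k_smooth_on_const)
qed auto

lemma k_smooth_on_add:
  assumes "open S"
  shows "k_smooth_on k S f \<Longrightarrow> k_smooth_on k S g \<Longrightarrow> k_smooth_on k S (\<lambda>x. f x + g x)"
proof (induction k arbitrary: f g)
  case 0
  then show ?case by (auto intro: continuous_on_add)
next
  case (Suc k)
  show ?case
    by (rule k_smooth_on_SucI[OF assms has_derivative_add[OF k_smooth_on_SucD[OF Suc.prems(1)] k_smooth_on_SucD[OF Suc.prems(2)]]])
      (use Suc in auto)
qed

lemma k_smooth_on_sum:
  assumes "open S" "\<And>i. i \<in> I \<Longrightarrow> k_smooth_on k S (f i)"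
  shows "k_smooth_on k S (\<lambda>x. \<Sum>i\<in>I. f i x)"
  using assms(2)
  by (induction I rule: infinite_finite_induct)
    (auto intro!: k_smooth_on_const k_smooth_on_add[OF assms(1)])

lemma k_smooth_on_mult:
  fixes f g :: "'a::euclidean_space \<Rightarrow> real"
  assumes "open S"
  shows "k_smooth_on k S f \<Longrightarrow> k_smooth_on k S g \<Longrightarrow> k_smooth_on k S (\<lambda>x. f x * g x)"
proof (induction k arbitrary: f g)
  case 0
  then show ?case by (auto intro: continuous_on_mult)
next
  case (Suc k)
  show ?case
  proof (rule k_smooth_on_SucI[OF assms has_derivative_mult[OF k_smooth_on_SucD[OF Suc.prems(1)] k_smooth_on_SucD[OF Suc.prems(2)]]])
    show "k_smooth_on k S (\<lambda>x. f x * frechet_derivative g (at x) v + frechet_derivative f (at x) v * g x)" for v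
      using Suc.prems k_smooth_on_Suc_imp[OF Suc.prems(1)] k_smooth_on_Suc_imp[OF Suc.prems(2)]
      by (intro k_smooth_on_add[OF assms] Suc.IH) auto
  qed
qed

text \<open>By the chain rule, the derivative of the composition in a direction is a sum over a basis of products
of a directional derivative of \<open>g\<close>, composed with \<open>f\<close>, and a component of the derivative of \<open>f\<close>.
The first factor is covered by the induction hypothesis for that derivative of \<open>g\<close>, and products are
covered by the Leibniz rule; this is why \<open>g\<close> varies in the induction and \<open>f\<close> does not.\<close>
lemma k_smooth_on_compose:
  fixes f :: "'a::euclidean_space \<Rightarrow> 'b::euclidean_space" and g :: "'b \<Rightarrow> real"
  assumes "open S" "open T" "f ` S \<subseteq> T"
  shows "k_smooth_on k S f \<Longrightarrow> k_smooth_on k T g \<Longrightarrow> k_smooth_on k S (\<lambda>x. g (f x))"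
proof (induction k arbitrary: g)
  case 0
  then show ?case using continuous_on_compose2 assms(3) by auto
next
  case (Suc k)
  have D: "((\<lambda>x. g (f x)) has_derivative
      (\<lambda>v. \<Sum>b\<in>Basis. (frechet_derivative f (at x) v \<bullet> b) * frechet_derivative g (at (f x)) b)) (at x)"
    if "x \<in> S" for x
  proof -
    have fx: "f x \<in> T" using assms(3) that by auto
    have g': "(g has_derivative frechet_derivative g (at (f x))) (at (f x))"
      using k_smooth_on_SucD[OF Suc.prems(2) fx] .
    have "frechet_derivative g (at (f x)) w =
        (\<Sum>b\<in>Basis. (w \<bullet> b) * frechet_derivative g (at (f x)) b)" for w
      by (rule linear_sum_Basis[OF has_derivative_linear[OF g']])
    then have eq: "frechet_derivative g (at (f x)) = (\<lambda>w. \<Sum>b\<in>Basis. (w \<bullet> b) * frechet_derivative g (at (f x)) b)"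
      by blast
    show ?thesis
      using has_derivative_compose[OF k_smooth_on_SucD[OF Suc.prems(1) that] g'] 
      by (subst (asm) eq) (simp add: o_def)
  qed
  show ?case
  proof (rule k_smooth_on_SucI[OF assms(1) D])
    fix v
    have "k_smooth_on k S (\<lambda>x. frechet_derivative g (at (f x)) b)" for b
      using Suc.IH[of "\<lambda>y. frechet_derivative g (at y) b"] Suc.prems k_smooth_on_Suc_imp[OF Suc.prems(1)] by auto
    moreover have "k_smooth_on k S (\<lambda>x. frechet_derivative f (at x) v \<bullet> b)" for b
      using Suc.prems by (intro k_smooth_on_bounded_linear_comp[OF assms(1) bounded_linear_inner_left]) auto
    ultimately show "k_smooth_on k S (\<lambda>x. \<Sum>b\<in>Basis. (frechet_derivative f (at x) v \<bullet> b) * frechet_derivative g (at (f x)) b)"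
      by (intro k_smooth_on_sum[OF assms(1)] k_smooth_on_mult[OF assms(1)])
  qed
qed

lemma smooth_on_D: "smooth_on S f \<Longrightarrow> k_smooth_on k S f"
  by (simp add: smooth_on_def)

lemma smooth_on_cong:
  "smooth_on S f \<Longrightarrow> open S \<Longrightarrow> (\<And>x. x \<in> S \<Longrightarrow> f x = g x) \<Longrightarrow> smooth_on S g"
  unfolding smooth_on_def using k_smooth_on_cong by blast

lemma smooth_on_subset: "smooth_on S f \<Longrightarrow> T \<subseteq> S \<Longrightarrow> smooth_on T f"
  unfolding smooth_on_def using k_smooth_on_subset by blast

lemma smooth_on_Un: "open S \<Longrightarrow> open T \<Longrightarrow> smooth_on S f \<Longrightarrow> smooth_on T f \<Longrightarrow> smooth_on (S \<union> T) f"
  unfolding smooth_on_def using k_smooth_on_Un by blast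

lemma smooth_on_const: "smooth_on S (\<lambda>x. c)"
  unfolding smooth_on_def using k_smooth_on_const by blast

lemma smooth_on_add: "open S \<Longrightarrow> smooth_on S f \<Longrightarrow> smooth_on S g \<Longrightarrow> smooth_on S (\<lambda>x. f x + g x)"
  unfolding smooth_on_def using k_smooth_on_add by blast

lemma smooth_on_mult:
  fixes f g :: "'a::euclidean_space \<Rightarrow> real"
  shows "open S \<Longrightarrow> smooth_on S f \<Longrightarrow> smooth_on S g \<Longrightarrow> smooth_on S (\<lambda>x. f x * g x)"
  unfolding smooth_on_def using k_smooth_on_mult by blast

lemma smooth_on_bounded_linear: "open S \<Longrightarrow> bounded_linear h \<Longrightarrow> smooth_on S h"
  unfolding smooth_on_def
  using k_smooth_on_bounded_linear_comp[OF _ _ k_smooth_on_ident] by blast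

lemma smooth_on_compose:
  fixes f :: "'a::euclidean_space \<Rightarrow> 'b::euclidean_space" and g :: "'b \<Rightarrow> real"
  shows "open S \<Longrightarrow> open T \<Longrightarrow> f ` S \<subseteq> T \<Longrightarrow> smooth_on S f \<Longrightarrow> smooth_on T g \<Longrightarrow> smooth_on S (\<lambda>x. g (f x))"
  unfolding smooth_on_def using k_smooth_on_compose by blast

lemma smooth_on_deriv:
  "smooth_on S f \<Longrightarrow> smooth_on S (\<lambda>x. frechet_derivative f (at x) v)"
  unfolding smooth_on_def using k_smooth_on.simps(2) by blast

lemma smooth_on_differentiable:
  "smooth_on S f \<Longrightarrow> x \<in> S \<Longrightarrow> f differentiable (at x)"
  unfolding smooth_on_def using k_smooth_on.simps(2) by blast

lemma smooth_on_continuous: "smooth_on S f \<Longrightarrow> continuous_on S f"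
  unfolding smooth_on_def using k_smooth_on.simps(1) by blast

lemma smooth_on_minus:
  fixes f g :: "'a::euclidean_space \<Rightarrow> real"
  shows "open S \<Longrightarrow> smooth_on S f \<Longrightarrow> smooth_on S g \<Longrightarrow> smooth_on S (\<lambda>x. f x - g x)"
  using smooth_on_add[of S f "\<lambda>x. -1 * g x"] smooth_on_mult[of S "\<lambda>_. -1" g] smooth_on_const by fastforce

section \<open>Bump functions\<close>

text \<open>The factors \<open>t\<^sup>-\<^sup>m\<close> are included because the family is then closed under
differentiation up to linear combinations, so smoothness of all its members is one induction.\<close>
definition flat_exp :: "nat \<Rightarrow> real \<Rightarrow> real" where
  "flat_exp m t = (if t > 0 then inverse t ^ m * exp (- inverse t) else 0)"

lemma flat_exp_has_derivative:
  "(flat_exp m has_real_derivative (flat_exp (m + 2) t - real m * flat_exp (m + 1) t)) (at t)"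
proof -
  consider "t > 0" | "t < 0" | "t = 0" by linarith
  then show ?thesis
  proof cases
    case 1
    have "((\<lambda>t. inverse t ^ m * exp (- inverse t)) has_real_derivative
        (flat_exp (m + 2) t - real m * flat_exp (m + 1) t)) (at t)"
      using 1 by (auto intro!: derivative_eq_intros simp: flat_exp_def power2_eq_square algebra_simps)
        (cases m; simp add: algebra_simps)
    then show ?thesis
      by (rule has_field_derivative_transform_within_open[where S="{0<..}"]) (use 1 in \<open>auto simp: flat_exp_def\<close>)
  next
    case 2
    have "((\<lambda>t. 0) has_real_derivative (flat_exp (m + 2) t - real m * flat_exp (m + 1) t)) (at t)"
      using 2 by (auto simp: flat_exp_def)
    then show ?thesis
      by (rule has_field_derivative_transform_within_open[where S="{..<0}"]) (use 2 in \<open>auto simp: flat_exp_def\<close>)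
  next
    case 3
    \<comment> \<open>The difference quotient at 0 is the next member of the family.\<close>
    have "((\<lambda>h. flat_exp (m + 1) h) \<longlongrightarrow> 0) (at_right 0)"
    proof -
      have "((\<lambda>x::real. x ^ (m + 1) / exp x) \<longlongrightarrow> 0) at_top"
        by (rule tendsto_power_div_exp_0)
      then have "((\<lambda>h::real. inverse h ^ (m + 1) / exp (inverse h)) \<longlongrightarrow> 0) (at_right 0)"
        by (rule filterlim_compose[OF _ filterlim_inverse_at_top_right])
      then show ?thesis
        by (rule Lim_transform_eventually)
          (auto simp: eventually_at_right_less flat_exp_def exp_minus field_simps intro!: eventually_at_rightI[of 0 1])
    qed
    moreover have "((\<lambda>h. flat_exp (m + 1) h) \<longlongrightarrow> 0) (at_left 0)"
      by (rule Lim_transform_eventually[OF tendsto_const])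
        (auto simp: flat_exp_def intro!: eventually_at_leftI[of "-1" 0])
    ultimately have "((\<lambda>h. flat_exp (m + 1) h) \<longlongrightarrow> 0) (at 0)"
      by (rule filterlim_split_at[rotated])
    then have "((\<lambda>h. (flat_exp m (0 + h) - flat_exp m 0) / h) \<longlongrightarrow> 0) (at 0)"
      by (rule Lim_transform_eventually)
        (auto simp: flat_exp_def field_simps eventually_at_filter)
    then show ?thesis using 3 by (simp add: DERIV_def flat_exp_def)
  qed
qed

lemma smooth_on_flat_exp: "smooth_on UNIV (flat_exp m)"
proof -
  have "k_smooth_on k UNIV (flat_exp m)" for k
  proof (induction k arbitrary: m)
    case 0
    show ?case
      using flat_exp_has_derivative DERIV_continuous_on[of UNIV "flat_exp m"] by fastforce
  next
    case (Suc k)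
    show ?case
    proof (rule k_smooth_on_SucI)
      show "(flat_exp m has_derivative (*) (flat_exp (m + 2) t - real m * flat_exp (m + 1) t)) (at t)" for t
        using flat_exp_has_derivative unfolding has_field_derivative_def .
      have "k_smooth_on k UNIV (\<lambda>t. (flat_exp (m + 2) t + (- real m) * flat_exp (m + 1) t) * v)" for v
        by (intro k_smooth_on_mult k_smooth_on_add k_smooth_on_const Suc) auto
      then show "k_smooth_on k UNIV (\<lambda>t. (flat_exp (m + 2) t - real m * flat_exp (m + 1) t) * v)" for v
        by simp
    qed auto
  qed
  then show ?thesis by (simp add: smooth_on_def)
qed

text \<open>Let \<open>h\<close> be \<open>exp (-1/t)\<close> for \<open>t > 0\<close> and 0 elsewhere.  The function \<open>h (|x - y|\<^sup>2 - r\<^sup>2)\<close> vanishes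
on the ball of radius \<open>r\<close> and is at least \<open>c = h (3 r\<^sup>2)\<close> outside the ball of radius \<open>2 r\<close>.
Therefore \<open>h (c - h (|x - y|\<^sup>2 - r\<^sup>2)) / h c\<close> is a bump function.  Unlike the usual quotient of
two such functions, it is smooth by composition alone.\<close>
lemma smooth_bump:
  fixes y :: "'a::euclidean_space"
  assumes "r > 0"
  obtains \<beta> :: "'a \<Rightarrow> real" where "smooth_on UNIV \<beta>"
    "\<And>x. x \<in> ball y r \<Longrightarrow> \<beta> x = 1" "\<And>x. x \<notin> ball y (2 * r) \<Longrightarrow> \<beta> x = 0"
proof -
  define h where "h = flat_exp 0"
  define c where "c = h (3 * r\<^sup>2)"
  define \<rho> where "\<rho> = (\<lambda>x. \<Sum>b\<in>Basis. (x \<bullet> b + - (y \<bullet> b)) * (x \<bullet> b + - (y \<bullet> b)))"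
  define \<beta> where "\<beta> = (\<lambda>x. inverse (h c) * h (c + (-1) * h (\<rho> x + - (r\<^sup>2))))"
  have \<rho>: "\<rho> x = (dist y x)\<^sup>2" for x
  proof -
    have "(dist y x)\<^sup>2 = (\<Sum>b\<in>Basis. (dist (y \<bullet> b) (x \<bullet> b))\<^sup>2)"
      by (subst euclidean_dist_l2) (simp add: L2_set_def sum_nonneg)
    also have "\<dots> = \<rho> x"
      unfolding \<rho>_def by (intro sum.cong) (auto simp: dist_real_def power2_eq_square algebra_simps)
    finally show ?thesis by simp
  qed
  have pos: "h t > 0" if "t > 0" for t using that by (simp add: h_def flat_exp_def)
  have zero: "h t = 0" if "t \<le> 0" for t using that by (simp add: h_def flat_exp_def)
  have mono: "h s \<le> h t" if "0 < s" "s \<le> t" for s t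
    using that by (simp add: h_def flat_exp_def)
  have "c > 0" using pos assms by (simp add: c_def)
  have hs: "smooth_on UNIV h" unfolding h_def by (rule smooth_on_flat_exp)
  have "smooth_on UNIV \<rho>"
    unfolding \<rho>_def smooth_on_def
    by (intro allI k_smooth_on_sum k_smooth_on_mult k_smooth_on_add k_smooth_on_const
        smooth_on_D[OF smooth_on_bounded_linear] bounded_linear_inner_left) auto
  then have "smooth_on UNIV \<beta>"
    unfolding \<beta>_def
    by (intro smooth_on_mult smooth_on_const smooth_on_compose[OF _ _ _ _ hs] smooth_on_add) auto
  moreover have "\<beta> x = 1" if "x \<in> ball y r" for x
  proof -
    have "\<rho> x \<le> r\<^sup>2" unfolding \<rho> using that by (intro power_mono) auto
    then show ?thesis using zero pos[OF \<open>c > 0\<close>] by (simp add: \<beta>_def)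
  qed
  moreover have "\<beta> x = 0" if "x \<notin> ball y (2 * r)" for x
  proof -
    have "(2 * r)\<^sup>2 \<le> \<rho> x" unfolding \<rho> using that assms by (intro power_mono) auto
    then have "c \<le> h (\<rho> x + - (r\<^sup>2))"
      unfolding c_def using assms by (intro mono) (auto simp: power2_eq_square)
    then show ?thesis using zero by (simp add: \<beta>_def)
  qed
  ultimately show ?thesis using that by blast
qed

section \<open>Hadamard's lemma\<close>

lemma convex_segment_point:
  fixes S :: "'a::real_vector set"
  assumes "convex S" "y \<in> S" "x \<in> S" "t \<in> {0..1}"
  shows "y + t *\<^sub>R (x - y) \<in> S"
proof -
  have "(1 - t) *\<^sub>R y + t *\<^sub>R x \<in> S"
    using assms by (intro convexD) auto
  then show ?thesis by (simp add: algebra_simps)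
qed

text \<open>Differentiating under the integral sign reproduces an integral of the same form, with a directional
derivative of \<open>f\<close> in place of \<open>f\<close> and one more factor \<open>t\<close>.  The weight \<open>t\<^sup>m\<close> and arbitrary
\<open>f\<close> make this an induction on the order of differentiability.\<close>
lemma k_smooth_on_segment_integral:
  fixes f :: "'a::euclidean_space \<Rightarrow> real"
  assumes "open S" "convex S" "y \<in> S"
  shows "k_smooth_on k S f \<Longrightarrow>
    k_smooth_on k S (\<lambda>x. integral (cbox 0 1) (\<lambda>t. t ^ m * f (y + t *\<^sub>R (x - y))))"
proof (induction k arbitrary: f m)
  have seg: "y + t *\<^sub>R (x - y) \<in> S" if "x \<in> S" "t \<in> cbox 0 (1::real)" for x t
    using convex_segment_point[OF assms(2,3) that(1)] that(2) by simp
  have cont: "continuous_on (S \<times> cbox 0 1) (\<lambda>(x, t). t ^ m * f (y + t *\<^sub>R (x - y)))"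
    if "continuous_on S f" for f :: "'a \<Rightarrow> real" and m
    unfolding split_beta
    by (intro continuous_intros continuous_on_compose2[OF that]) (use seg in auto)
  {
    case 0
    then show ?case using integral_continuous_on_param[OF cont] by simp
  next
    case (Suc k)
    have fc: "continuous_on S f"
      using k_smooth_on_continuous[OF Suc.prems] .
    define fx :: "'a \<Rightarrow> real \<Rightarrow> 'a \<Rightarrow>\<^sub>L real" where
      "fx = (\<lambda>x t. Blinfun (\<lambda>v. t ^ (m + 1) * frechet_derivative f (at (y + t *\<^sub>R (x - y))) v))"
    have fx: "blinfun_apply (fx x t) = (\<lambda>v. t ^ (m + 1) * frechet_derivative f (at (y + t *\<^sub>R (x - y))) v)"
      if "x \<in> S" "t \<in> cbox 0 1" for x t
      unfolding fx_def
      by (rule bounded_linear_Blinfun_apply bounded_linear_const_mult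
          has_derivative_bounded_linear[OF k_smooth_on_SucD[OF Suc.prems seg[OF that]]])+
    have cfx: "continuous_on (S \<times> cbox 0 1) (\<lambda>(x, t). fx x t)"
    proof (rule continuous_on_blinfun_componentwise)
      fix i :: 'a
      have "k_smooth_on k S (\<lambda>x. frechet_derivative f (at x) i)" using Suc.prems by simp
      then have "continuous_on S (\<lambda>x. frechet_derivative f (at x) i)"
        by (rule k_smooth_on_continuous)
      from cont[OF this, of "m + 1"]
      show "continuous_on (S \<times> cbox 0 1) (\<lambda>x. blinfun_apply (case x of (x, t) \<Rightarrow> fx x t) i)"
        by (rule continuous_on_eq) (auto simp: fx)
    qed
    have D: "((\<lambda>x. t ^ m * f (y + t *\<^sub>R (x - y))) has_derivative blinfun_apply (fx x t)) (at x within S)"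
      if "x \<in> S" "t \<in> cbox 0 1" for x t
    proof -
      have g: "((\<lambda>x. y + t *\<^sub>R (x - y)) has_derivative (\<lambda>v. t *\<^sub>R v)) (at x within S)"
        by (auto intro!: derivative_eq_intros)
      have f: "(f has_derivative frechet_derivative f (at (y + t *\<^sub>R (x - y)))) (at (y + t *\<^sub>R (x - y)))"
        by (rule k_smooth_on_SucD[OF Suc.prems seg[OF that]])
      have "((\<lambda>x. t ^ m * f (y + t *\<^sub>R (x - y))) has_derivative
          (\<lambda>v. t ^ m * frechet_derivative f (at (y + t *\<^sub>R (x - y))) (t *\<^sub>R v))) (at x within S)"
        by (intro has_derivative_mult_right has_derivative_compose[OF g f])
      then show ?thesis
        unfolding fx[OF that]
        by (simp add: linear_cmul[OF has_derivative_linear[OF f]] mult.assoc mult.left_commute)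
    qed
    show ?case
    proof (rule k_smooth_on_SucI[OF assms(1)])
      fix x assume x: "x \<in> S"
      have int: "(\<lambda>t. t ^ m * f (y + t *\<^sub>R (x - y))) integrable_on cbox 0 1" if "x \<in> S" for x
        by (intro integrable_continuous continuous_intros continuous_on_compose2[OF fc])
          (use seg that in auto)
      have cx: "continuous_on (cbox 0 1) (fx x)"
      proof -
        have "continuous_on (cbox 0 1) (\<lambda>t. (x, t))" by (intro continuous_intros)
        from continuous_on_compose2[OF cfx this] x show ?thesis by auto
      qed
      have eq: "blinfun_apply (integral (cbox 0 1) (fx x)) =
          (\<lambda>v. integral (cbox 0 1) (\<lambda>t. t ^ (m + 1) * frechet_derivative f (at (y + t *\<^sub>R (x - y))) v))"
      proof
        fix v
        have "blinfun_apply (integral (cbox 0 1) (fx x)) v = integral (cbox 0 1) (\<lambda>t. blinfun_apply (fx x t) v)"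
          using blinfun_apply_integral[OF integrable_continuous[OF cx]] .
        also have "\<dots> = integral (cbox 0 1) (\<lambda>t. t ^ (m + 1) * frechet_derivative f (at (y + t *\<^sub>R (x - y))) v)"
          by (rule integral_cong) (simp add: fx x)
        finally show "blinfun_apply (integral (cbox 0 1) (fx x)) v = \<dots>" .
      qed
      have "((\<lambda>x. integral (cbox 0 1) (\<lambda>t. t ^ m * f (y + t *\<^sub>R (x - y)))) has_derivative
         blinfun_apply (integral (cbox 0 1) (fx x))) (at x within S)"
        by (rule leibniz_rule[OF D int cfx x assms(2)])
      then show "((\<lambda>x. integral (cbox 0 1) (\<lambda>t. t ^ m * f (y + t *\<^sub>R (x - y)))) has_derivative
         (\<lambda>v. integral (cbox 0 1) (\<lambda>t. t ^ (m + 1) * frechet_derivative f (at (y + t *\<^sub>R (x - y))) v))) (at x)"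
        unfolding eq using at_within_open[OF x assms(1)] by simp
    next
      fix v
      show "k_smooth_on k S (\<lambda>x. integral (cbox 0 1) (\<lambda>t. t ^ (m + 1) * frechet_derivative f (at (y + t *\<^sub>R (x - y))) v))"
        by (rule Suc.IH) (use Suc.prems in simp)
    qed
  }
qed

text \<open>The coefficient of the coordinate \<open>b\<close> is the mean of the partial derivative along the segment from
\<open>y\<close> to \<open>x\<close>.\<close>
lemma hadamard:
  fixes f :: "'a::euclidean_space \<Rightarrow> real"
  assumes S: "open S" "convex S" "y \<in> S" and f: "smooth_on S f"
  obtains h where "\<And>b. smooth_on S (h b)"
    "\<And>x. x \<in> S \<Longrightarrow> f x = f y + (\<Sum>b\<in>Basis. ((x - y) \<bullet> b) * h b x)"
    "\<And>b. h b y = frechet_derivative f (at y) b"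
proof
  define h where "h = (\<lambda>b x. integral (cbox 0 1) (\<lambda>t. t ^ 0 * frechet_derivative f (at (y + t *\<^sub>R (x - y))) b))"
  show "smooth_on S (h b)" for b
    using k_smooth_on_segment_integral[OF S, of _ "\<lambda>x. frechet_derivative f (at x) b" 0]
      smooth_on_deriv[OF f] unfolding smooth_on_def h_def by blast
  show "h b y = frechet_derivative f (at y) b" for b
    by (simp add: h_def)
  fix x assume x: "x \<in> S"
  have seg: "y + t *\<^sub>R (x - y) \<in> S" if "t \<in> {0..1}" for t
    by (rule convex_segment_point[OF S(2,3) x that])
  have D: "(f has_derivative frechet_derivative f (at z)) (at z)" if "z \<in> S" for z
    using smooth_on_differentiable[OF f that] frechet_derivative_works by blast
  have rep: "frechet_derivative f (at z) (x - y) =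
      (\<Sum>b\<in>Basis. ((x - y) \<bullet> b) * frechet_derivative f (at z) b)" if "z \<in> S" for z
    by (rule linear_sum_Basis[OF has_derivative_linear[OF D[OF that]]])
  have "((\<lambda>t. frechet_derivative f (at (y + t *\<^sub>R (x - y))) (x - y)) has_integral
      (f (y + 1 *\<^sub>R (x - y)) - f (y + 0 *\<^sub>R (x - y)))) {0..1}"
  proof (rule fundamental_theorem_of_calculus)
    fix t :: real assume t: "t \<in> {0..1}"
    have g: "((\<lambda>t. y + t *\<^sub>R (x - y)) has_derivative (\<lambda>s. s *\<^sub>R (x - y))) (at t within {0..1})"
      by (auto intro!: derivative_eq_intros)
    have f': "(f has_derivative frechet_derivative f (at (y + t *\<^sub>R (x - y)))) (at (y + t *\<^sub>R (x - y)))"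
      by (rule D[OF seg[OF t]])
    show "((\<lambda>t. f (y + t *\<^sub>R (x - y))) has_vector_derivative
        frechet_derivative f (at (y + t *\<^sub>R (x - y))) (x - y)) (at t within {0..1})"
      using has_derivative_compose[OF g f']
      by (simp add: has_vector_derivative_def linear_cmul[OF has_derivative_linear[OF f']])
  qed simp
  then have I: "((\<lambda>t. frechet_derivative f (at (y + t *\<^sub>R (x - y))) (x - y)) has_integral f x - f y) {0..1}"
    by simp
  have J: "((\<lambda>t. \<Sum>b\<in>Basis. ((x - y) \<bullet> b) * frechet_derivative f (at (y + t *\<^sub>R (x - y))) b) has_integral
      (\<Sum>b\<in>Basis. ((x - y) \<bullet> b) * h b x)) {0..1}"
  proof (intro has_integral_sum has_integral_mult_right)
    fix b :: 'a
    have "continuous_on {0..1} (\<lambda>t. frechet_derivative f (at (y + t *\<^sub>R (x - y))) b)"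
      by (intro continuous_on_compose2[OF smooth_on_continuous[OF smooth_on_deriv[OF f]]] continuous_intros)
        (use seg in auto)
    then show "((\<lambda>t. frechet_derivative f (at (y + t *\<^sub>R (x - y))) b) has_integral h b x) {0..1}"
      unfolding h_def by (simp add: integrable_integral integrable_continuous_real)
  qed simp
  have "f x - f y = (\<Sum>b\<in>Basis. ((x - y) \<bullet> b) * h b x)"
    by (rule has_integral_unique[OF I has_integral_eq[OF _ J]]) (use rep seg in auto)
  then show "f x = f y + (\<Sum>b\<in>Basis. ((x - y) \<bullet> b) * h b x)" by simp
qed

section \<open>Smooth functions and derivations on a manifold\<close>

lemma chart_facts:
  assumes "smooth_manifold A" "(U, \<phi>) \<in> A"
  shows "open U" "open (\<phi> ` U)" "continuous_on U \<phi>" "continuous_on (\<phi> ` U) (inv_into U \<phi>)"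
    "\<And>q. q \<in> U \<Longrightarrow> inv_into U \<phi> (\<phi> q) = q"
proof -
  have *: "open U \<and> open (\<phi> ` U) \<and> homeomorphism U (\<phi> ` U) \<phi> (inv_into U \<phi>)"
    using assms unfolding smooth_manifold_def by blast
  then show "open U" "open (\<phi> ` U)" "continuous_on U \<phi>" "continuous_on (\<phi> ` U) (inv_into U \<phi>)"
    "\<And>q. q \<in> U \<Longrightarrow> inv_into U \<phi> (\<phi> q) = q"
    by (auto simp: homeomorphism_def)
qed

lemma open_chart_image:
  assumes "smooth_manifold A" "(U, \<phi>) \<in> A" "open W"
  shows "open (\<phi> ` (U \<inter> W))"
proof -
  note c = chart_facts[OF assms(1,2)]
  have "open (\<phi> ` U \<inter> inv_into U \<phi> -` W)"
    using continuous_open_preimage[OF c(4,2) assms(3)] .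
  moreover have "\<phi> ` U \<inter> inv_into U \<phi> -` W = \<phi> ` (U \<inter> W)"
    using c(5) by auto
  ultimately show ?thesis by simp
qed

lemma smooth_functions_const: "(\<lambda>q. c) \<in> smooth_functions A"
  by (auto simp: smooth_functions_def o_def smooth_on_const)

lemma smooth_functions_add:
  assumes "smooth_manifold A" "f \<in> smooth_functions A" "h \<in> smooth_functions A"
  shows "f + h \<in> smooth_functions A"
  using assms chart_facts(2)[OF assms(1)]
  by (auto simp: smooth_functions_def o_def intro!: smooth_on_add)

lemma smooth_functions_mult:
  assumes "smooth_manifold A" "f \<in> smooth_functions A" "h \<in> smooth_functions A"
  shows "f * h \<in> smooth_functions A"
  using assms chart_facts(2)[OF assms(1)]
  by (auto simp: smooth_functions_def o_def intro!: smooth_on_mult)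

lemma smooth_functions_cmult:
  assumes "smooth_manifold A" "f \<in> smooth_functions A"
  shows "(\<lambda>q. c * f q) \<in> smooth_functions A"
  using smooth_functions_mult[OF assms(1) smooth_functions_const assms(2), of c]
  by (simp add: times_fun_def)

lemma smooth_functions_0: "0 \<in> smooth_functions A"
  using smooth_functions_const[of 0] by (simp add: zero_fun_def)

lemma sum_fun_apply: "(\<Sum>i\<in>I. f i) x = (\<Sum>i\<in>I. f i x)" for f :: "'i \<Rightarrow> 'a \<Rightarrow> 'b::comm_monoid_add"
  by (induction I rule: infinite_finite_induct) auto

lemma smooth_functions_sum:
  assumes "smooth_manifold A" "\<And>i. i \<in> I \<Longrightarrow> f i \<in> smooth_functions A"
  shows "(\<Sum>i\<in>I. f i) \<in> smooth_functions A"
  using assms(2)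
  by (induction I rule: infinite_finite_induct)
    (auto intro: smooth_functions_0 smooth_functions_add[OF assms(1)])

definition chart_ext :: "'m set \<Rightarrow> ('m \<Rightarrow> real ^ 'n) \<Rightarrow> (real ^ 'n \<Rightarrow> real) \<Rightarrow> 'm \<Rightarrow> real" where
  "chart_ext U \<phi> F = (\<lambda>q. if q \<in> U then F (\<phi> q) else 0)"

text \<open>Extension by zero.  The manifold is covered by the preimage of \<open>S\<close> and the complement of the
preimage of \<open>K\<close>; the latter is open because compact sets are closed in a Hausdorff space.  On the first set
smoothness in other charts comes from the coordinate changes, on the second the function is 0.\<close>
lemma chart_ext_smooth:
  fixes A :: "('m::{t2_space, second_countable_topology}, 'n::finite) atlas"
  assumes M: "smooth_manifold A" and U: "(U, \<phi>) \<in> A"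
    and S: "open S" "S \<subseteq> \<phi> ` U" and K: "compact K" "K \<subseteq> S"
    and F: "smooth_on S F" "\<And>x. x \<notin> K \<Longrightarrow> F x = 0"
  shows "chart_ext U \<phi> F \<in> smooth_functions A"
  unfolding smooth_functions_def
proof (intro CollectI ballI, clarify)
  fix V \<psi> assume V: "(V, \<psi>) \<in> A"
  note cU = chart_facts[OF M U] and cV = chart_facts[OF M V]
  define G where "G = chart_ext U \<phi> F \<circ> inv_into V \<psi>"
  define \<tau> where "\<tau> = \<phi> \<circ> inv_into V \<psi>"
  define C where "C = inv_into U \<phi> ` K"
  define W0 where "W0 = \<psi> ` (V \<inter> U)"
  have W0: "open W0" unfolding W0_def by (rule open_chart_image[OF M V cU(1)])
  have \<tau>: "smooth_on W0 \<tau>"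
    using M U V unfolding smooth_manifold_def W0_def \<tau>_def by blast
  define W1 where "W1 = W0 \<inter> \<tau> -` S"
  have W1: "open W1" unfolding W1_def
    by (rule continuous_open_preimage[OF smooth_on_continuous[OF \<tau>] W0 S(1)])
  have "continuous_on K (inv_into U \<phi>)"
    using cU(4) continuous_on_subset K S by blast
  then have "closed C" unfolding C_def
    using K compact_continuous_image compact_imp_closed by blast
  define W2 where "W2 = \<psi> ` (V \<inter> - C)"
  have W2: "open W2" unfolding W2_def
    by (rule open_chart_image[OF M V]) (use \<open>closed C\<close> in auto)
  have "smooth_on W1 (\<lambda>x. F (\<tau> x))"
    by (rule smooth_on_compose[OF W1 S(1) _ smooth_on_subset[OF \<tau>] F(1)]) (auto simp: W1_def)
  then have "smooth_on W1 G"
    by (rule smooth_on_cong[OF _ W1]) (auto simp: W1_def W0_def G_def \<tau>_def chart_ext_def cV(5))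
  moreover have "smooth_on W2 G"
  proof (rule smooth_on_cong[OF smooth_on_const W2])
    fix x assume "x \<in> W2"
    then obtain q where q: "x = \<psi> q" "q \<in> V" "q \<notin> C" by (auto simp: W2_def)
    have "F (\<phi> q) = 0" if "q \<in> U"
      using F(2)[of "\<phi> q"] q(3) cU(5)[OF that] by (force simp: C_def)
    then show "0 = G x" using q cV(5) by (simp add: G_def chart_ext_def)
  qed
  ultimately have "smooth_on (W1 \<union> W2) G" by (rule smooth_on_Un[OF W1 W2])
  moreover have "\<psi> ` V \<subseteq> W1 \<union> W2"
  proof
    fix x assume "x \<in> \<psi> ` V"
    then obtain q where q: "x = \<psi> q" "q \<in> V" by auto
    show "x \<in> W1 \<union> W2"
    proof (cases "q \<in> C")
      case True
      then obtain z where z: "z \<in> K" "q = inv_into U \<phi> z" by (auto simp: C_def)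
      then have "z \<in> \<phi> ` U" using K S by auto
      then have "q \<in> U" "\<phi> q = z" using z by (auto simp: inv_into_into f_inv_into_f)
      then show ?thesis using q z K cV(5) by (auto simp: W1_def W0_def \<tau>_def)
    qed (use q in \<open>auto simp: W2_def\<close>)
  qed
  ultimately show "smooth_on (\<psi> ` V) (chart_ext U \<phi> F \<circ> inv_into V \<psi>)"
    unfolding G_def by (rule smooth_on_subset)
qed

definition chart_deriv :: "'m set \<Rightarrow> ('m \<Rightarrow> real ^ 'n) \<Rightarrow> 'n::finite \<Rightarrow> ('m \<Rightarrow> real) \<Rightarrow> real ^ 'n \<Rightarrow> real" where
  "chart_deriv U \<phi> i f x = frechet_derivative (f \<circ> inv_into U \<phi>) (at x) (axis i 1)"

lemma smooth_functions_chart: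
  "f \<in> smooth_functions A \<Longrightarrow> (U, \<phi>) \<in> A \<Longrightarrow> smooth_on (\<phi> ` U) (f \<circ> inv_into U \<phi>)"
  unfolding smooth_functions_def by blast

lemma smooth_on_chart_deriv:
  "f \<in> smooth_functions A \<Longrightarrow> (U, \<phi>) \<in> A \<Longrightarrow> smooth_on (\<phi> ` U) (chart_deriv U \<phi> i f)"
  unfolding chart_deriv_def by (rule smooth_on_deriv[OF smooth_functions_chart])

lemma has_derivative_chart:
  "f \<in> smooth_functions A \<Longrightarrow> (U, \<phi>) \<in> A \<Longrightarrow> x \<in> \<phi> ` U \<Longrightarrow>
   (f \<circ> inv_into U \<phi> has_derivative frechet_derivative (f \<circ> inv_into U \<phi>) (at x)) (at x)"
  using smooth_functions_chart smooth_on_differentiable frechet_derivative_works by blast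

lemma chart_deriv_eqI:
  "(f \<circ> inv_into U \<phi> has_derivative D) (at x) \<Longrightarrow> chart_deriv U \<phi> i f x = D (axis i 1)"
  unfolding chart_deriv_def using frechet_derivative_at by metis

lemma chart_deriv_rules:
  assumes "f \<in> smooth_functions A" "h \<in> smooth_functions A" "(U, \<phi>) \<in> A" "x \<in> \<phi> ` U"
  shows "chart_deriv U \<phi> i (f + h) x = chart_deriv U \<phi> i f x + chart_deriv U \<phi> i h x"
    and "chart_deriv U \<phi> i (f * h) x =
      chart_deriv U \<phi> i f x * h (inv_into U \<phi> x) + f (inv_into U \<phi> x) * chart_deriv U \<phi> i h x"
    and "chart_deriv U \<phi> i (\<lambda>q. c * f q) x = c * chart_deriv U \<phi> i f x"
proof -
  note f = has_derivative_chart[OF assms(1,3,4)] and h = has_derivative_chart[OF assms(2,3,4)]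
  show "chart_deriv U \<phi> i (f + h) x = chart_deriv U \<phi> i f x + chart_deriv U \<phi> i h x"
    by (subst chart_deriv_eqI[where D = "\<lambda>v. frechet_derivative (f \<circ> inv_into U \<phi>) (at x) v + frechet_derivative (h \<circ> inv_into U \<phi>) (at x) v"])
      (use has_derivative_add[OF f h] in \<open>auto simp: chart_deriv_def o_def\<close>)
  show "chart_deriv U \<phi> i (f * h) x =
      chart_deriv U \<phi> i f x * h (inv_into U \<phi> x) + f (inv_into U \<phi> x) * chart_deriv U \<phi> i h x"
    by (subst chart_deriv_eqI[where D = "\<lambda>v. f (inv_into U \<phi> x) * frechet_derivative (h \<circ> inv_into U \<phi>) (at x) v + frechet_derivative (f \<circ> inv_into U \<phi>) (at x) v * h (inv_into U \<phi> x)"])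
      (use has_derivative_mult[OF f h] in \<open>auto simp: chart_deriv_def o_def\<close>)
  show "chart_deriv U \<phi> i (\<lambda>q. c * f q) x = c * chart_deriv U \<phi> i f x"
    by (subst chart_deriv_eqI[where D = "\<lambda>v. c * frechet_derivative (f \<circ> inv_into U \<phi>) (at x) v"])
      (use has_derivative_mult_right[OF f] in \<open>auto simp: chart_deriv_def o_def\<close>)
qed

lemma tangent_spaceD:
  assumes "v \<in> tangent_space A p"
  shows "f \<notin> smooth_functions A \<Longrightarrow> v f = 0"
    and "f \<in> smooth_functions A \<Longrightarrow> v (\<lambda>q. c * f q) = c * v f"
    and "f \<in> smooth_functions A \<Longrightarrow> h \<in> smooth_functions A \<Longrightarrow> v (f + h) = v f + v h"
    and "f \<in> smooth_functions A \<Longrightarrow> h \<in> smooth_functions A \<Longrightarrow> v (f * h) = v f * h p + f p * v h"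
  using assms unfolding tangent_space_def by blast+

lemma tangent_space_sum:
  assumes "smooth_manifold A" "v \<in> tangent_space A p" "\<And>i. i \<in> I \<Longrightarrow> f i \<in> smooth_functions A"
  shows "v (\<Sum>i\<in>I. f i) = (\<Sum>i\<in>I. v (f i))"
proof -
  have 0: "v 0 = 0"
    using tangent_spaceD(2)[OF assms(2) smooth_functions_0, of 0] by (simp add: zero_fun_def)
  show ?thesis
    using assms(3)
    by (induction I rule: infinite_finite_induct)
      (auto simp: 0 tangent_spaceD(3)[OF assms(2)] smooth_functions_sum[OF assms(1)])
qed

lemma sum_Basis_axis:
  fixes f :: "real ^ 'n \<Rightarrow> 'c::comm_monoid_add"
  shows "(\<Sum>b\<in>Basis. f b) = (\<Sum>i\<in>UNIV. f (axis i 1))"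
proof -
  have "bij_betw (\<lambda>i. axis i 1 :: real ^ 'n) UNIV Basis"
    by (auto simp: bij_betw_def inj_def axis_eq_axis Basis_vec_def)
  from sum.reindex_bij_betw[OF this, of f] show ?thesis by simp
qed

text \<open>A point derivation is determined by the partial derivatives at the point: with a bump function \<open>b\<close> with
\<open>b q = 1\<close>, Hadamard's lemma reads \<open>b\<^sup>2 f = f(q) b\<^sup>2 + \<Sum> a\<^sub>i k\<^sub>i\<close> on the whole manifold, where
\<open>a\<^sub>i\<close> is \<open>b\<close> times the \<open>i\<close>-th coordinate relative to \<open>q\<close> and \<open>k\<^sub>i\<close> is \<open>b\<close> times a Hadamard
coefficient.  Applying \<open>v\<close> to both sides leaves \<open>v f = \<Sum> v(a\<^sub>i) k\<^sub>i(q)\<close>, since \<open>a\<^sub>i(q) = 0\<close>.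
The functions \<open>a\<^sub>i\<close> do not depend on \<open>f\<close>.\<close>
lemma tangent_vector_chart_expansion:
  fixes A :: "('m::{t2_space, second_countable_topology}, 'n::finite) atlas"
  assumes M: "smooth_manifold A" and U: "(U, \<phi>) \<in> A" and q: "q \<in> U"
  obtains a :: "'n \<Rightarrow> 'm \<Rightarrow> real" where
    "\<And>v f. v \<in> tangent_space A q \<Longrightarrow> f \<in> smooth_functions A \<Longrightarrow>
      v f = (\<Sum>i\<in>UNIV. v (a i) * chart_deriv U \<phi> i f (\<phi> q))"
proof -
  note c = chart_facts[OF M U]
  define y where "y = \<phi> q"
  have "y \<in> \<phi> ` U" using q by (simp add: y_def)
  then obtain e where e: "e > 0" "ball y e \<subseteq> \<phi> ` U" using c(2) openE by blast
  define r where "r = e / 3"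
  have r: "r > 0" "cball y (2 * r) \<subseteq> ball y e" using e by (auto simp: r_def)
  obtain \<beta> :: "real ^ 'n \<Rightarrow> real" where \<beta>: "smooth_on UNIV \<beta>"
    "\<And>x. x \<in> ball y r \<Longrightarrow> \<beta> x = 1" "\<And>x. x \<notin> ball y (2 * r) \<Longrightarrow> \<beta> x = 0"
    using smooth_bump[OF r(1)] by blast
  have ext: "chart_ext U \<phi> (\<lambda>x. \<beta> x * H x) \<in> smooth_functions A" if "smooth_on (ball y e) H" for H
  proof (rule chart_ext_smooth[OF M U _ e(2) _ r(2)])
    show "smooth_on (ball y e) (\<lambda>x. \<beta> x * H x)"
      by (intro smooth_on_mult that smooth_on_subset[OF \<beta>(1)]) auto
    show "\<beta> x * H x = 0" if "x \<notin> cball y (2 * r)" for x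
      using that \<beta>(3)[of x] by simp
  qed auto
  define a where "a = (\<lambda>i. chart_ext U \<phi> (\<lambda>x. \<beta> x * ((x - y) \<bullet> axis i 1)))"
  define b where "b = chart_ext U \<phi> (\<lambda>x. \<beta> x * 1)"
  have a: "a i \<in> smooth_functions A" for i
    unfolding a_def inner_diff_left
    by (intro ext smooth_on_minus smooth_on_const smooth_on_bounded_linear bounded_linear_inner_left) auto
  have b: "b \<in> smooth_functions A"
    unfolding b_def by (intro ext smooth_on_const)
  have bq: "b q = 1" using \<beta>(2)[of y] r q by (simp add: b_def chart_ext_def y_def)
  have aq: "a i q = 0" for i by (simp add: a_def chart_ext_def y_def)
  have "v f = (\<Sum>i\<in>UNIV. v (a i) * chart_deriv U \<phi> i f (\<phi> q))"
    if v: "v \<in> tangent_space A q" and f: "f \<in> smooth_functions A" for v f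
  proof -
    have "smooth_on (ball y e) (f \<circ> inv_into U \<phi>)"
      using smooth_on_subset[OF smooth_functions_chart[OF f U] e(2)] .
    moreover have "y \<in> ball y e" using e by simp
    ultimately obtain h where h: "\<And>b. smooth_on (ball y e) (h b)"
      "\<And>x. x \<in> ball y e \<Longrightarrow> (f \<circ> inv_into U \<phi>) x = (f \<circ> inv_into U \<phi>) y + (\<Sum>b\<in>Basis. ((x - y) \<bullet> b) * h b x)"
      "\<And>b. h b y = frechet_derivative (f \<circ> inv_into U \<phi>) (at y) b"
      using hadamard[OF open_ball convex_ball] by blast
    define k where "k = (\<lambda>i. chart_ext U \<phi> (\<lambda>x. \<beta> x * h (axis i 1) x))"
    have k: "k i \<in> smooth_functions A" for i unfolding k_def by (intro ext h)
    have kq: "k i q = chart_deriv U \<phi> i f (\<phi> q)" for i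
      using \<beta>(2)[of y] r q h(3) by (simp add: k_def chart_ext_def chart_deriv_def flip: y_def)
    have bb: "b * b \<in> smooth_functions A" using smooth_functions_mult[OF M b b] .
    have ak: "a i * k i \<in> smooth_functions A" for i using smooth_functions_mult[OF M a k] .
    have eq: "(b * b) * f = (\<lambda>z. f q * (b * b) z) + (\<Sum>i\<in>UNIV. a i * k i)"
    proof
      fix z
      show "((b * b) * f) z = ((\<lambda>z. f q * (b * b) z) + (\<Sum>i\<in>UNIV. a i * k i)) z"
      proof (cases "z \<in> U \<and> \<phi> z \<in> ball y e")
        case True
        define S where "S = (\<Sum>i\<in>UNIV. ((\<phi> z - y) \<bullet> axis i 1) * h (axis i 1) (\<phi> z))"
        have "f z = f q + S"
          using h(2)[of "\<phi> z"] True c(5) q by (simp add: sum_Basis_axis y_def S_def)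
        moreover have "(\<Sum>i\<in>UNIV. a i z * k i z) = \<beta> (\<phi> z) * \<beta> (\<phi> z) * S"
          using True by (simp add: a_def k_def chart_ext_def S_def sum_distrib_left mult_ac)
        ultimately show ?thesis
          using True by (simp add: sum_fun_apply b_def chart_ext_def algebra_simps)
      next
        case False
        then have "z \<in> U \<Longrightarrow> \<beta> (\<phi> z) = 0" using r(2) \<beta>(3)[of "\<phi> z"] by (meson ball_subset_cball subset_eq)
        then show ?thesis by (auto simp: sum_fun_apply a_def k_def b_def chart_ext_def)
      qed
    qed
    have "v ((b * b) * f) = v (b * b) * f q + v f"
      using tangent_spaceD(4)[OF v bb f] bq by simp
    moreover have "v ((\<lambda>z. f q * (b * b) z) + (\<Sum>i\<in>UNIV. a i * k i)) =
      f q * v (b * b) + (\<Sum>i\<in>UNIV. v (a i * k i))"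
    proof -
      have "(\<Sum>i\<in>UNIV. a i * k i) \<in> smooth_functions A" by (rule smooth_functions_sum[OF M ak])
      from tangent_spaceD(3)[OF v smooth_functions_cmult[OF M bb] this]
      show ?thesis using tangent_spaceD(2)[OF v bb] tangent_space_sum[OF M v ak] by simp
    qed
    moreover have "v (a i * k i) = v (a i) * chart_deriv U \<phi> i f (\<phi> q)" for i
      using tangent_spaceD(4)[OF v a k] aq kq by simp
    ultimately show ?thesis using eq by simp
  qed
  then show ?thesis using that by blast
qed

text \<open>Coordinate fields \<open>E i\<close>, coordinate functions \<open>\<xi> i\<close> and a cutoff \<open>\<omega>\<close>, all defined on the whole manifold.
The last property is the coordinate expression of a point derivation near \<open>p\<close>, multiplied by
\<open>\<omega>\<close> so that it holds at every point: \<open>\<omega>\<close> and \<open>E i\<close> are cut off with a bump function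
supported where the cutoff in \<open>\<xi> i\<close> is still 1.\<close>
lemma local_frame:
  fixes A :: "('m::{t2_space, second_countable_topology}, 'n::finite) atlas" and p :: 'm
  assumes M: "smooth_manifold A"
  obtains E :: "'n \<Rightarrow> 'm vfield" and \<xi> :: "'n \<Rightarrow> 'm \<Rightarrow> real" and \<omega> :: "'m \<Rightarrow> real"
  where "\<And>i. E i \<in> vector_fields A" "\<And>i. \<xi> i \<in> smooth_functions A" "\<omega> \<in> smooth_functions A"
    "\<omega> p = 1" "\<And>i j. E i (\<xi> j) p = (if i = j then 1 else 0)"
    "\<And>q v f. v \<in> tangent_space A q \<Longrightarrow> f \<in> smooth_functions A \<Longrightarrow>
      \<omega> q * v f = (\<Sum>i\<in>UNIV. v (\<xi> i) * E i f q)"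
proof -
  obtain U \<phi> where U: "(U, \<phi>) \<in> A" and p: "p \<in> U"
  proof -
    have "(\<Union>(U, \<phi>)\<in>A. U) = UNIV" using M unfolding smooth_manifold_def by (rule conjunct1)
    then have "p \<in> (\<Union>(U, \<phi>)\<in>A. U)" by (simp only: UNIV_I)
    then show ?thesis using that by auto
  qed
  note c = chart_facts[OF M U]
  define y where "y = \<phi> p"
  have "y \<in> \<phi> ` U" using p by (simp add: y_def)
  then obtain e where e: "e > 0" "cball y e \<subseteq> \<phi> ` U" using c(2) open_contains_cball by blast
  define r where "r = e / 4"
  have r: "r > 0" "2 * r > 0" "2 * (2 * r) = e" using e by (auto simp: r_def)
  obtain \<gamma> :: "real ^ 'n \<Rightarrow> real" where \<gamma>: "smooth_on UNIV \<gamma>"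
    "\<And>x. x \<in> ball y r \<Longrightarrow> \<gamma> x = 1" "\<And>x. x \<notin> ball y (2 * r) \<Longrightarrow> \<gamma> x = 0"
    using smooth_bump[OF r(1), of y] by blast
  obtain \<beta> :: "real ^ 'n \<Rightarrow> real" where \<beta>: "smooth_on UNIV \<beta>"
    "\<And>x. x \<in> ball y (2 * r) \<Longrightarrow> \<beta> x = 1" "\<And>x. x \<notin> ball y e \<Longrightarrow> \<beta> x = 0"
    using smooth_bump[OF r(2), of y] unfolding r(3) by blast
  have ext: "chart_ext U \<phi> (\<lambda>x. b x * H x) \<in> smooth_functions A"
    if "smooth_on (\<phi> ` U) H" "smooth_on UNIV b" "\<And>x. x \<notin> ball y e \<Longrightarrow> b x = 0" for b H
  proof (rule chart_ext_smooth[OF M U c(2) order_refl compact_cball e(2)])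
    show "smooth_on (\<phi> ` U) (\<lambda>x. b x * H x)"
      by (intro smooth_on_mult that(1) smooth_on_subset[OF that(2)] c) auto
    show "b x * H x = 0" if "x \<notin> cball y e" for x
      using that \<open>\<And>x. x \<notin> ball y e \<Longrightarrow> b x = 0\<close>[of x] by simp
  qed
  have \<gamma>0: "\<gamma> x = 0" if "x \<notin> ball y e" for x
    using that r by (intro \<gamma>(3)) auto
  define \<omega> where "\<omega> = chart_ext U \<phi> (\<lambda>x. \<gamma> x * 1)"
  define \<xi> where "\<xi> = (\<lambda>i. chart_ext U \<phi> (\<lambda>x. \<beta> x * (x $ i)))"
  define E where "E = (\<lambda>i f. if f \<in> smooth_functions A then chart_ext U \<phi> (\<lambda>x. \<gamma> x * chart_deriv U \<phi> i f x) else 0)"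
  have \<omega>: "\<omega> \<in> smooth_functions A" unfolding \<omega>_def by (rule ext[OF smooth_on_const \<gamma>(1) \<gamma>0])
  have \<xi>: "\<xi> i \<in> smooth_functions A" for i unfolding \<xi>_def
    by (rule ext[OF smooth_on_bounded_linear[OF c(2) bounded_linear_vec_nth] \<beta>(1,3)])
  have E: "E i \<in> vector_fields A" for i
    unfolding vector_fields_def
  proof (intro CollectI conjI ballI allI impI)
    show "E i f = 0" if "f \<notin> smooth_functions A" for f using that by (simp add: E_def)
    show "E i f \<in> smooth_functions A" if f: "f \<in> smooth_functions A" for f
      using f ext[OF smooth_on_chart_deriv[OF f U] \<gamma>(1) \<gamma>0] by (simp add: E_def)
    show "E i (\<lambda>q. c * f q) = (\<lambda>q. c * E i f q)" if f: "f \<in> smooth_functions A" for f c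
      using f smooth_functions_cmult[OF M f] chart_deriv_rules(3)[OF f f U]
      by (auto simp: E_def chart_ext_def)
    fix f h assume f: "f \<in> smooth_functions A" and h: "h \<in> smooth_functions A"
    show "E i (f + h) = E i f + E i h"
      using f h smooth_functions_add[OF M f h] chart_deriv_rules(1)[OF f h U]
      by (auto simp: E_def chart_ext_def algebra_simps)
    show "E i (f * h) = E i f * h + f * E i h"
      using f h smooth_functions_mult[OF M f h] chart_deriv_rules(2)[OF f h U] c(5)
      by (auto simp: E_def chart_ext_def algebra_simps)
  qed
  have d\<xi>: "chart_deriv U \<phi> i (\<xi> j) x = (if i = j then 1 else 0)" if x: "x \<in> ball y (2 * r)" for i j x
  proof -
    have "ball y (2 * r) \<subseteq> \<phi> ` U" using e r by auto
    then have eq: "z $ j = (\<xi> j \<circ> inv_into U \<phi>) z" if "z \<in> ball y (2 * r)" for z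
      using that \<beta>(2)[OF that] by (auto simp: \<xi>_def chart_ext_def inv_into_into f_inv_into_f)
    have "((\<lambda>z. z $ j) has_derivative (\<lambda>v. v $ j)) (at x)"
      by (rule bounded_linear_imp_has_derivative[OF bounded_linear_vec_nth])
    then have "(\<xi> j \<circ> inv_into U \<phi> has_derivative (\<lambda>v. v $ j)) (at x)"
      by (rule has_derivative_transform_within_open[OF _ open_ball x eq])
    then show ?thesis by (simp add: chart_deriv_eqI axis_def)
  qed
  show ?thesis
  proof (rule that[OF E \<xi> \<omega>])
    show "\<omega> p = 1" using \<gamma>(2)[of y] r p by (simp add: \<omega>_def chart_ext_def y_def)
    show "E i (\<xi> j) p = (if i = j then 1 else 0)" for i j
      using \<gamma>(2)[of y] r p d\<xi>[of y] \<xi> by (simp add: E_def chart_ext_def flip: y_def)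
    fix q v f assume v: "v \<in> tangent_space A q" and f: "f \<in> smooth_functions A"
    show "\<omega> q * v f = (\<Sum>i\<in>UNIV. v (\<xi> i) * E i f q)"
    proof (cases "q \<in> U \<and> \<phi> q \<in> ball y (2 * r)")
      case False
      then have "q \<in> U \<Longrightarrow> \<gamma> (\<phi> q) = 0" using \<gamma>(3) by blast
      then show ?thesis using f by (auto simp: \<omega>_def E_def chart_ext_def)
    next
      case True
      obtain a :: "'n \<Rightarrow> 'm \<Rightarrow> real" where a:
        "\<And>v f. v \<in> tangent_space A q \<Longrightarrow> f \<in> smooth_functions A \<Longrightarrow>
          v f = (\<Sum>i\<in>UNIV. v (a i) * chart_deriv U \<phi> i f (\<phi> q))"
        using tangent_vector_chart_expansion[OF M U] True by blast
      have "v (\<xi> j) = v (a j)" for j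
      proof -
        have "v (\<xi> j) = (\<Sum>i\<in>UNIV. v (a i) * (if i = j then 1 else 0))"
          using a[OF v \<xi>, of j] d\<xi> True by simp
        then show ?thesis by (simp add: if_distrib cong: if_cong)
      qed
      then show ?thesis
        using a[OF v f] True f by (simp add: \<omega>_def E_def chart_ext_def sum_distrib_left mult_ac)
    qed
  qed
qed

section \<open>Maps that are linear over the smooth functions\<close>

lemma vector_fieldsD:
  assumes "X \<in> vector_fields A"
  shows "f \<notin> smooth_functions A \<Longrightarrow> X f = 0"
    and "f \<in> smooth_functions A \<Longrightarrow> X f \<in> smooth_functions A"
    and "f \<in> smooth_functions A \<Longrightarrow> X (\<lambda>q. c * f q) = (\<lambda>q. c * X f q)"
    and "f \<in> smooth_functions A \<Longrightarrow> h \<in> smooth_functions A \<Longrightarrow> X (f + h) = X f + X h"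
    and "f \<in> smooth_functions A \<Longrightarrow> h \<in> smooth_functions A \<Longrightarrow> X (f * h) = X f * h + f * X h"
  using assms unfolding vector_fields_def by blast+

lemma value_at_tangent: "X \<in> vector_fields A \<Longrightarrow> value_at X p \<in> tangent_space A p"
  unfolding tangent_space_def value_at_def by (auto simp: vector_fieldsD)

lemma vector_fields_add:
  assumes "smooth_manifold A" "X \<in> vector_fields A" "Y \<in> vector_fields A"
  shows "X + Y \<in> vector_fields A"
  unfolding vector_fields_def
  by (auto simp: vector_fieldsD[OF assms(2)] vector_fieldsD[OF assms(3)] fun_eq_iff algebra_simps
      intro!: smooth_functions_add[OF assms(1)])

lemma vector_fields_fscale:
  assumes "smooth_manifold A" "f \<in> smooth_functions A" "X \<in> vector_fields A"
  shows "fscale f X \<in> vector_fields A"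
  unfolding vector_fields_def fscale_def
  by (auto simp: vector_fieldsD[OF assms(3)] fun_eq_iff algebra_simps
      intro!: smooth_functions_mult[OF assms(1,2)])

lemma vector_fields_0: "0 \<in> vector_fields A"
  unfolding vector_fields_def by (auto intro: smooth_functions_0)

lemma vector_fields_sum:
  assumes "smooth_manifold A" "\<And>i. i \<in> I \<Longrightarrow> X i \<in> vector_fields A"
  shows "(\<Sum>i\<in>I. X i) \<in> vector_fields A"
  using assms(2)
  by (induction I rule: infinite_finite_induct)
    (auto intro: vector_fields_0 vector_fields_add[OF assms(1)])

lemma fscale_minus_one: "fscale (\<lambda>_. -1) X = - X"
  by (intro ext) (simp add: fscale_def)

lemma vector_fields_uminus:
  assumes "smooth_manifold A" "X \<in> vector_fields A"
  shows "- X \<in> vector_fields A"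
  using vector_fields_fscale[OF assms(1) smooth_functions_const assms(2), of "-1"]
  by (simp add: fscale_minus_one)

lemma vector_fields_diff:
  assumes "smooth_manifold A" "X \<in> vector_fields A" "Y \<in> vector_fields A"
  shows "X - Y \<in> vector_fields A"
  using vector_fields_add[OF assms(1,2) vector_fields_uminus[OF assms(1,3)]] by simp

definition tensorial :: "('m, 'n::finite) atlas \<Rightarrow> ('m vfield \<Rightarrow> 'm \<Rightarrow> real) \<Rightarrow> bool" where
  "tensorial A \<beta> \<longleftrightarrow>
     (\<forall>X\<in>vector_fields A. \<forall>Y\<in>vector_fields A. \<beta> (X + Y) = \<beta> X + \<beta> Y) \<and>
     (\<forall>f\<in>smooth_functions A. \<forall>X\<in>vector_fields A. \<beta> (fscale f X) = f * \<beta> X)"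

lemma tensorial_sum:
  assumes "smooth_manifold A" "tensorial A \<beta>" "\<And>i. i \<in> I \<Longrightarrow> f i \<in> smooth_functions A"
    "\<And>i. i \<in> I \<Longrightarrow> X i \<in> vector_fields A"
  shows "\<beta> (\<Sum>i\<in>I. fscale (f i) (X i)) = (\<Sum>i\<in>I. f i * \<beta> (X i))"
proof -
  have "\<beta> (fscale 0 0) = 0 * \<beta> 0"
    using assms(2) smooth_functions_0[of A] vector_fields_0[of A] unfolding tensorial_def by blast
  then have 0: "\<beta> 0 = 0" by (simp add: fscale_def zero_fun_def times_fun_def)
  show ?thesis
    using assms(3,4)
  proof (induction I rule: infinite_finite_induct)
    case (insert i I)
    have "\<beta> (fscale (f i) (X i) + (\<Sum>i\<in>I. fscale (f i) (X i))) = \<beta> (fscale (f i) (X i)) + \<beta> (\<Sum>i\<in>I. fscale (f i) (X i))"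
      using assms(2) insert.prems unfolding tensorial_def
      by (simp add: vector_fields_fscale[OF assms(1)] vector_fields_sum[OF assms(1)])
    moreover have "\<beta> (fscale (f i) (X i)) = f i * \<beta> (X i)"
      using assms(2) insert.prems unfolding tensorial_def by blast
    moreover have "\<beta> (\<Sum>i\<in>I. fscale (f i) (X i)) = (\<Sum>i\<in>I. f i * \<beta> (X i))"
      by (rule insert.IH) (use insert.prems in auto)
    ultimately show ?case by (simp only: sum.insert[OF insert.hyps])
  qed (auto simp: 0)
qed

text \<open>A map that is linear over the smooth functions depends on a vector field only through its value at the point:
by \<open>local_frame\<close> the field \<open>\<omega> Z\<close> is \<open>\<Sum> Z(\<xi>\<^sub>i) E\<^sub>i\<close>, so
\<open>\<beta>(Z)(p) = \<Sum> Z(\<xi>\<^sub>i)(p) \<beta>(E\<^sub>i)(p)\<close>, and \<open>Z(\<xi>\<^sub>i)(p)\<close> is linear in the value of \<open>Z\<close> at \<open>p\<close>.\<close>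
lemma tensorial_expand:
  fixes A :: "('m::{t2_space, second_countable_topology}, 'n::finite) atlas"
  assumes M: "smooth_manifold A" and \<beta>: "tensorial A \<beta>" and X: "X \<in> vector_fields A"
    and Y: "\<And>i. i \<in> I \<Longrightarrow> Y i \<in> vector_fields A"
    and eq: "value_at X p = (\<lambda>f. \<Sum>i\<in>I. c i * value_at (Y i) p f)"
  shows "\<beta> X p = (\<Sum>i\<in>I. c i * \<beta> (Y i) p)"
proof -
  obtain E :: "'n \<Rightarrow> 'm vfield" and \<xi> :: "'n \<Rightarrow> 'm \<Rightarrow> real" and \<omega> :: "'m \<Rightarrow> real"
    where E: "\<And>i. E i \<in> vector_fields A" and \<xi>: "\<And>i. \<xi> i \<in> smooth_functions A"
    and \<omega>: "\<omega> \<in> smooth_functions A" "\<omega> p = 1"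
    and d: "\<And>i j. E i (\<xi> j) p = (if i = j then 1 else 0)"
    and fr: "\<And>q v f. v \<in> tangent_space A q \<Longrightarrow> f \<in> smooth_functions A \<Longrightarrow>
      \<omega> q * v f = (\<Sum>i\<in>UNIV. v (\<xi> i) * E i f q)"
    by (rule local_frame[OF M, of p]) (rule that)
  have *: "\<beta> Z p = (\<Sum>i\<in>UNIV. Z (\<xi> i) p * \<beta> (E i) p)" if Z: "Z \<in> vector_fields A" for Z
  proof -
    have "fscale \<omega> Z = (\<Sum>i\<in>UNIV. fscale (Z (\<xi> i)) (E i))"
    proof (intro ext)
      fix f q
      show "fscale \<omega> Z f q = (\<Sum>i\<in>UNIV. fscale (Z (\<xi> i)) (E i)) f q"
      proof (cases "f \<in> smooth_functions A")
        case True
        then show ?thesis using fr[OF value_at_tangent[OF Z] True, of q]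
          by (simp add: fscale_def sum_fun_apply value_at_def)
      qed (simp add: fscale_def sum_fun_apply vector_fieldsD(1)[OF Z] vector_fieldsD(1)[OF E])
    qed
    then have "\<beta> (fscale \<omega> Z) = (\<Sum>i\<in>UNIV. Z (\<xi> i) * \<beta> (E i))"
      using tensorial_sum[OF M \<beta>, of UNIV "\<lambda>i. Z (\<xi> i)" E] E vector_fieldsD(2)[OF Z \<xi>] by simp
    moreover have "\<beta> (fscale \<omega> Z) = \<omega> * \<beta> Z" using \<beta> Z \<omega> unfolding tensorial_def by blast
    ultimately have "(\<omega> * \<beta> Z) p = (\<Sum>i\<in>UNIV. Z (\<xi> i) * \<beta> (E i)) p" by simp
    then show ?thesis using \<omega> by (simp add: sum_fun_apply)
  qed
  have "X f p = (\<Sum>i\<in>I. c i * Y i f p)" for f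
    using fun_cong[OF eq, of f] by (simp add: value_at_def)
  then have "\<beta> X p = (\<Sum>j\<in>UNIV. \<Sum>i\<in>I. c i * Y i (\<xi> j) p * \<beta> (E j) p)"
    using *[OF X] by (simp add: sum_distrib_right)
  also have "\<dots> = (\<Sum>i\<in>I. c i * (\<Sum>j\<in>UNIV. Y i (\<xi> j) p * \<beta> (E j) p))"
    by (subst sum.swap) (simp add: sum_distrib_left mult.assoc)
  also have "\<dots> = (\<Sum>i\<in>I. c i * \<beta> (Y i) p)"
    by (intro sum.cong) (auto simp: *[OF Y])
  finally show ?thesis .
qed

text \<open>The fields of \<open>local_frame\<close> form a basis at \<open>p\<close>: they span because \<open>\<omega> p = 1\<close>, and the coordinate functions
\<open>\<xi> i\<close> separate them.  So the choice in \<^const>\<open>basis_at\<close> is never vacuous.\<close>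
lemma tangent_basis_basis_at:
  fixes A :: "('m::{t2_space, second_countable_topology}, 'n::finite) atlas"
  assumes M: "smooth_manifold A"
  shows "tangent_basis A p (basis_at A p)"
proof -
  obtain E :: "'n \<Rightarrow> 'm vfield" and \<xi> :: "'n \<Rightarrow> 'm \<Rightarrow> real" and \<omega> :: "'m \<Rightarrow> real"
    where E: "\<And>i. E i \<in> vector_fields A" and \<xi>: "\<And>i. \<xi> i \<in> smooth_functions A"
    and \<omega>: "\<omega> \<in> smooth_functions A" "\<omega> p = 1" and d: "\<And>i j. E i (\<xi> j) p = (if i = j then 1 else 0)"
    and fr: "\<And>q v f. v \<in> tangent_space A q \<Longrightarrow> f \<in> smooth_functions A \<Longrightarrow>
      \<omega> q * v f = (\<Sum>i\<in>UNIV. v (\<xi> i) * E i f q)"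
    by (rule local_frame[OF M, of p]) (rule that)
  have "tangent_basis A p E"
    unfolding tangent_basis_def
  proof (intro conjI allI ballI ex1I)
    fix v assume v: "v \<in> tangent_space A p"
    show "v = (\<lambda>f. \<Sum>i\<in>UNIV. (\<chi> i. v (\<xi> i)) $ i * value_at (E i) p f)"
    proof
      fix f
      show "v f = (\<Sum>i\<in>UNIV. (\<chi> i. v (\<xi> i)) $ i * value_at (E i) p f)"
        by (cases "f \<in> smooth_functions A")
          (use fr[OF v, of f] \<omega> in \<open>auto simp: value_at_def tangent_spaceD(1)[OF v] vector_fieldsD(1)[OF E]\<close>)
    qed
    fix c :: "real ^ 'n" assume c: "v = (\<lambda>f. \<Sum>i\<in>UNIV. c $ i * value_at (E i) p f)"
    show "c = (\<chi> i. v (\<xi> i))"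
      unfolding vec_eq_iff c by (simp add: value_at_def d if_distrib cong: if_cong)
  qed (rule E)
  then show ?thesis unfolding basis_at_def by (rule someI[of "tangent_basis A p"])
qed

section \<open>Contraction with a Riemannian metric\<close>

lemma additive_diff:
  fixes A :: "('m::{t2_space, second_countable_topology}, 'n::finite) atlas" and L :: "'m vfield \<Rightarrow> 'b::ab_group_add"
  assumes "smooth_manifold A" "\<And>X Y. X \<in> vector_fields A \<Longrightarrow> Y \<in> vector_fields A \<Longrightarrow> L (X + Y) = L X + L Y"
    and "X \<in> vector_fields A" "Y \<in> vector_fields A"
  shows "L (X - Y) = L X - L Y"
  using assms(2)[OF vector_fields_diff[OF assms(1,3,4)] assms(4)] by simp

lemma id_tensor: "tensor_field_1_1 A (\<lambda>X. X)"
  by (simp add: tensor_field_1_1_def)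

text \<open>The contraction at a single point, for real-valued forms.  With the point fixed, nested contractions
become ordinary double sums.\<close>
definition metric_trace ::
  "('m, 'n::finite) atlas \<Rightarrow> ('m vfield \<Rightarrow> 'm vfield \<Rightarrow> 'm \<Rightarrow> real) \<Rightarrow> 'm \<Rightarrow>
   ('m vfield \<Rightarrow> 'm vfield \<Rightarrow> real) \<Rightarrow> real" where
  "metric_trace A g p b = (\<Sum>i\<in>UNIV. \<Sum>j\<in>UNIV.
     inverse_gram A g p $ i $ j * b (basis_at A p i) (basis_at A p j))"

lemma contract_eq_metric_trace: "contract A g B p = metric_trace A g p (\<lambda>X Y. B X Y p)"
  by (simp add: contract_def metric_trace_def)

locale riemannian_manifold =
  fixes A :: "('m::{t2_space, second_countable_topology}, 'n::finite) atlas"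
    and g :: "'m vfield \<Rightarrow> 'm vfield \<Rightarrow> 'm \<Rightarrow> real"
  assumes manifold: "smooth_manifold A"
    and metric: "riemannian_metric A g"
begin

abbreviation VF :: "'m vfield set" where "VF \<equiv> vector_fields A"
abbreviation SF :: "('m \<Rightarrow> real) set" where "SF \<equiv> smooth_functions A"
abbreviation tr :: "'m \<Rightarrow> ('m vfield \<Rightarrow> 'm vfield \<Rightarrow> real) \<Rightarrow> real" where
  "tr \<equiv> metric_trace A g"

lemma VF_closed [simp]:
  "X \<in> VF \<Longrightarrow> Y \<in> VF \<Longrightarrow> X + Y \<in> VF"
  "X \<in> VF \<Longrightarrow> Y \<in> VF \<Longrightarrow> X - Y \<in> VF"
  "f \<in> SF \<Longrightarrow> X \<in> VF \<Longrightarrow> fscale f X \<in> VF"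
  "X \<in> VF \<Longrightarrow> f \<in> SF \<Longrightarrow> X f \<in> SF"
  "(\<lambda>q. c) \<in> SF"
  by (simp_all add: vector_fields_add[OF manifold] vector_fields_diff[OF manifold]
      vector_fields_fscale[OF manifold] vector_fieldsD smooth_functions_const)

lemma metric_smooth [simp]: "X \<in> VF \<Longrightarrow> Y \<in> VF \<Longrightarrow> g X Y \<in> SF"
  and metric_sym: "X \<in> VF \<Longrightarrow> Y \<in> VF \<Longrightarrow> g X Y = g Y X"
  and metric_add_left: "X \<in> VF \<Longrightarrow> Y \<in> VF \<Longrightarrow> Z \<in> VF \<Longrightarrow> g (X + Y) Z = g X Z + g Y Z"
  and metric_fscale_left: "f \<in> SF \<Longrightarrow> X \<in> VF \<Longrightarrow> Z \<in> VF \<Longrightarrow> g (fscale f X) Z = f * g X Z"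
  and metric_pos: "X \<in> VF \<Longrightarrow> value_at X p \<noteq> 0 \<Longrightarrow> g X X p > 0"
  using metric unfolding riemannian_metric_def by blast+

lemma metric_add_right: "X \<in> VF \<Longrightarrow> Y \<in> VF \<Longrightarrow> Z \<in> VF \<Longrightarrow> g X (Y + Z) = g X Y + g X Z"
  using metric_sym[of X "Y + Z"] metric_sym[of Y X] metric_sym[of Z X] by (simp add: metric_add_left)

lemma metric_diff_left: "X \<in> VF \<Longrightarrow> Y \<in> VF \<Longrightarrow> Z \<in> VF \<Longrightarrow> g (X - Y) Z = g X Z - g Y Z"
  using additive_diff[OF manifold, of "\<lambda>X. g X Z"] by (simp add: metric_add_left)

lemma metric_zero_left: "V \<in> VF \<Longrightarrow> g 0 V p = 0"
  using metric_diff_left[of V V V] by simp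

lemma metric_diff_right: "X \<in> VF \<Longrightarrow> Y \<in> VF \<Longrightarrow> Z \<in> VF \<Longrightarrow> g X (Y - Z) = g X Y - g X Z"
  using additive_diff[OF manifold, of "\<lambda>Y. g X Y"] by (simp add: metric_add_right)

lemma metric_fscale_right: "f \<in> SF \<Longrightarrow> X \<in> VF \<Longrightarrow> Y \<in> VF \<Longrightarrow> g X (fscale f Y) = f * g X Y"
  using metric_sym[of X "fscale f Y"] metric_sym[of Y X] by (simp add: metric_fscale_left)

lemmas metric_linear = metric_add_left metric_add_right metric_diff_left metric_diff_right
  metric_fscale_left metric_fscale_right

lemma metric_nondegenerate:
  assumes "X \<in> VF" "\<And>Z p. Z \<in> VF \<Longrightarrow> g X Z p = 0"
  shows "X = 0"
proof (intro ext)
  fix f p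
  have "value_at X p = 0" using metric_pos[OF assms(1), of p] assms(2)[OF assms(1), of p] by linarith
  then show "X f p = 0 f p" by (metis value_at_def zero_fun_apply)
qed

lemma tensorialI:
  assumes "\<And>X Y q. X \<in> VF \<Longrightarrow> Y \<in> VF \<Longrightarrow> \<beta> (X + Y) q = \<beta> X q + \<beta> Y q"
    and "\<And>f X q. f \<in> SF \<Longrightarrow> X \<in> VF \<Longrightarrow> \<beta> (fscale f X) q = f q * \<beta> X q"
  shows "tensorial A \<beta>"
  unfolding tensorial_def using assms by (auto simp: fun_eq_iff)

lemma tensorial_metric:
  assumes "tensor_field_1_1 A L" "Z \<in> VF"
  shows "tensorial A (\<lambda>X. g (L X) Z)" "tensorial A (\<lambda>X. g Z (L X))"
  using assms unfolding tensor_field_1_1_def by (auto intro!: tensorialI simp: metric_linear)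

lemma basis_at_VF [simp]: "basis_at A p i \<in> VF"
  using tangent_basis_basis_at[OF manifold, of p] unfolding tangent_basis_def by blast

lemma basis_at_expansion:
  assumes "X \<in> VF"
  shows "\<exists>!c::real^'n. value_at X p = (\<lambda>f. \<Sum>i\<in>UNIV. c $ i * value_at (basis_at A p i) p f)"
proof -
  have "\<forall>v\<in>tangent_space A p. \<exists>!c::real^'n. v = (\<lambda>f. \<Sum>i\<in>UNIV. c $ i * value_at (basis_at A p i) p f)"
    using tangent_basis_basis_at[OF manifold, of p] unfolding tangent_basis_def by (rule conjunct2)
  then show ?thesis using value_at_tangent[OF assms] by (rule bspec)
qed

definition gram :: "'m \<Rightarrow> real ^ 'n ^ 'n" where
  "gram p = (\<chi> i j. g (basis_at A p i) (basis_at A p j) p)"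

text \<open>A vector \<open>c\<close> in the kernel of the Gram matrix gives a field \<open>X = \<Sum> c\<^sub>i e\<^sub>i\<close> with \<open>g X X p = 0\<close>,
which has value 0 at \<open>p\<close> because the metric is positive definite, so \<open>c = 0\<close> by independence of the basis.\<close>
lemma inverse_gram: "gram p ** inverse_gram A g p = mat 1" "inverse_gram A g p ** gram p = mat 1"
proof -
  let ?E = "basis_at A p"
  have ker: "c = 0" if c: "gram p *v c = 0" for c
  proof -
    define X where "X = (\<Sum>i\<in>UNIV. fscale (\<lambda>_. c $ i) (?E i))"
    have X: "X \<in> VF" unfolding X_def by (intro vector_fields_sum[OF manifold]) auto
    have val: "value_at X p = (\<lambda>f. \<Sum>i\<in>UNIV. c $ i * value_at (?E i) p f)"
      by (simp add: X_def value_at_def sum_fun_apply fscale_def)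
    have "g X X p = (\<Sum>i\<in>UNIV. c $ i * g (?E i) X p)"
      by (rule tensorial_expand[OF manifold tensorial_metric(1)[OF id_tensor X] X _ val]) simp
    also have "\<dots> = (\<Sum>i\<in>UNIV. c $ i * (\<Sum>j\<in>UNIV. c $ j * g (?E i) (?E j) p))"
    proof (rule sum.cong[OF refl])
      fix i
      have "g (?E i) X p = (\<Sum>j\<in>UNIV. c $ j * g (?E i) (?E j) p)"
        by (rule tensorial_expand[OF manifold tensorial_metric(2)[OF id_tensor basis_at_VF] X _ val]) simp
      then show "c $ i * g (?E i) X p = c $ i * (\<Sum>j\<in>UNIV. c $ j * g (?E i) (?E j) p)" by simp
    qed
    also have "\<dots> = (\<Sum>i\<in>UNIV. c $ i * (gram p *v c) $ i)"
      by (simp add: gram_def matrix_vector_mult_def mult.commute)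
    also have "\<dots> = 0" unfolding c by simp
    finally have "value_at X p = 0" using metric_pos[OF X, of p] by (metis less_irrefl)
    then have "(\<lambda>f. \<Sum>i\<in>UNIV. c $ i * value_at (?E i) p f) = (\<lambda>f. \<Sum>i\<in>UNIV. (0::real^'n) $ i * value_at (?E i) p f)"
      using val by (simp add: zero_fun_def)
    then have "value_at X p = (\<lambda>f. \<Sum>i\<in>UNIV. (0::real^'n) $ i * value_at (?E i) p f)"
      using val by (rule trans[rotated])
    moreover obtain c0 where "\<forall>c::real^'n. value_at X p = (\<lambda>f. \<Sum>i\<in>UNIV. c $ i * value_at (?E i) p f) \<longrightarrow> c = c0"
      using basis_at_expansion[OF X, of p] by (rule ex1E)
    ultimately have "0 = c0" "c = c0" using val by simp_all
    then show "c = 0" by simp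
  qed
  then have "invertible (gram p)"
    unfolding invertible_left_inverse matrix_left_invertible_ker by blast
  then have "gram p ** matrix_inv (gram p) = mat 1 \<and> matrix_inv (gram p) ** gram p = mat 1"
    unfolding matrix_inv_def invertible_def by (rule someI_ex)
  then show "gram p ** inverse_gram A g p = mat 1" "inverse_gram A g p ** gram p = mat 1"
    by (simp_all add: inverse_gram_def gram_def)
qed

lemma inverse_gram_sym: "inverse_gram A g p $ i $ j = inverse_gram A g p $ j $ i"
proof -
  let ?H = "inverse_gram A g p"
  have "transpose (gram p) = gram p"
    unfolding transpose_def gram_def vec_eq_iff by (simp add: metric_sym[OF basis_at_VF basis_at_VF])
  then have "transpose ?H ** gram p = mat 1"
    using arg_cong[OF inverse_gram(1)[of p], of transpose] by (simp add: matrix_transpose_mul transpose_mat)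
  then have "(transpose ?H ** gram p) ** ?H = ?H" by simp
  then have "transpose ?H = ?H"
    unfolding matrix_mul_assoc[symmetric] by (simp add: inverse_gram)
  then have "transpose ?H $ i $ j = ?H $ i $ j" by simp
  then show ?thesis by (simp add: transpose_def)
qed

lemma tr_cong:
  "(\<And>X Y. X \<in> VF \<Longrightarrow> Y \<in> VF \<Longrightarrow> b X Y = c X Y) \<Longrightarrow> tr p b = tr p c"
  by (simp add: metric_trace_def)

lemma tr_add: "tr p (\<lambda>X Y. b X Y + c X Y) = tr p b + tr p c"
  by (simp add: metric_trace_def sum.distrib algebra_simps)

lemma tr_diff: "tr p (\<lambda>X Y. b X Y - c X Y) = tr p b - tr p c"
  by (simp add: metric_trace_def sum_subtractf algebra_simps)

lemma tr_mult: "tr p (\<lambda>X Y. k * b X Y) = k * tr p b"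
  by (simp add: metric_trace_def sum_distrib_left mult_ac)

lemma tr_minus: "tr p (\<lambda>X Y. - b X Y) = - tr p b"
  by (simp add: metric_trace_def sum_negf)

lemma tr_flip: "tr p (\<lambda>X Y. b Y X) = tr p b"
  unfolding metric_trace_def by (subst sum.swap) (simp add: inverse_gram_sym)

lemma tr_swap: "tr p (\<lambda>X X'. tr p (\<lambda>Y Y'. K X X' Y Y')) = tr p (\<lambda>Y Y'. tr p (\<lambda>X X'. K X X' Y Y'))"
proof -
  let ?H = "\<lambda>x. inverse_gram A g p $ fst x $ snd x" and ?E = "basis_at A p"
  have pairs: "tr p b = (\<Sum>x\<in>UNIV. ?H x * b (?E (fst x)) (?E (snd x)))" for b
    by (simp add: metric_trace_def sum.cartesian_product split_beta)
  show ?thesis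
    unfolding pairs sum_distrib_left
    by (subst sum.swap) (simp add: mult.left_commute)
qed

text \<open>Raising and lowering an index: contracting against \<open>g X\<close> evaluates at \<open>X\<close>.  This rule and the
symmetry \<open>tr_flip\<close> are all that later trace computations use of the inverse Gram matrix.\<close>
lemma tr_contract:
  assumes \<beta>: "tensorial A \<beta>" and X: "X \<in> VF"
  shows "tr p (\<lambda>Y Z. g X Y p * \<beta> Z p) = \<beta> X p"
proof -
  let ?H = "inverse_gram A g p" and ?E = "basis_at A p"
  obtain c :: "real ^ 'n" where c: "value_at X p = (\<lambda>f. \<Sum>i\<in>UNIV. c $ i * value_at (?E i) p f)"
    using basis_at_expansion[OF X, of p] by (rule ex1E)
  have "g X (?E k) p = (c v* gram p) $ k" for k
    using tensorial_expand[OF manifold tensorial_metric(1)[OF id_tensor basis_at_VF] X _ c, of p k]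
    by (simp add: vector_matrix_mult_def gram_def mult.commute)
  then have "(\<Sum>k\<in>UNIV. ?H $ k $ j * g X (?E k) p) = ((c v* gram p) v* ?H) $ j" for j
    by (simp add: vector_matrix_mult_def mult.commute)
  then have *: "(\<Sum>k\<in>UNIV. ?H $ k $ j * g X (?E k) p) = c $ j" for j
    by (simp add: vector_matrix_mul_assoc inverse_gram)
  have "tr p (\<lambda>Y Z. g X Y p * \<beta> Z p) = (\<Sum>j\<in>UNIV. (\<Sum>k\<in>UNIV. ?H $ k $ j * g X (?E k) p) * \<beta> (?E j) p)"
    unfolding metric_trace_def by (subst sum.swap) (simp add: sum_distrib_right mult.assoc)
  also have "\<dots> = \<beta> X p"
    unfolding * by (rule tensorial_expand[OF manifold \<beta> X _ c, symmetric]) simp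
  finally show ?thesis .
qed

text \<open>The trace of \<open>B\<close> against a self-adjoint \<open>L\<close> does not see the argument on which \<open>L\<close> acts.  The proof
expands \<open>L X\<close> with \<open>tr_contract\<close>, moves \<open>L\<close> to the other side of the metric and contracts again.\<close>
lemma tr_adjoint:
  assumes L: "tensor_field_1_1 A L"
    and self: "\<And>X Y. X \<in> VF \<Longrightarrow> Y \<in> VF \<Longrightarrow> g (L X) Y = g X (L Y)"
    and B: "\<And>Y. Y \<in> VF \<Longrightarrow> tensorial A (\<lambda>X. B X Y)" "\<And>X. X \<in> VF \<Longrightarrow> tensorial A (\<lambda>Y. B X Y)"
  shows "tr p (\<lambda>X Y. B (L X) Y p) = tr p (\<lambda>X Y. B X (L Y) p)"
proof -
  have LV: "L X \<in> VF" if "X \<in> VF" for X using L that unfolding tensor_field_1_1_def by blast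
  have "tr p (\<lambda>X Y. B (L X) Y p) = tr p (\<lambda>X Y. tr p (\<lambda>U V. g (L X) U p * B V Y p))"
    by (rule tr_cong) (simp add: tr_contract[OF B(1)] LV)
  also have "\<dots> = tr p (\<lambda>U V. tr p (\<lambda>X Y. g (L X) U p * B V Y p))"
    by (rule tr_swap)
  also have "\<dots> = tr p (\<lambda>U V. tr p (\<lambda>X Y. g (L U) X p * B V Y p))"
    by (intro tr_cong) (metis self metric_sym LV)
  also have "\<dots> = tr p (\<lambda>U V. B V (L U) p)"
    by (rule tr_cong) (simp add: tr_contract[OF B(2)] LV)
  also have "\<dots> = tr p (\<lambda>X Y. B X (L Y) p)"
    by (rule tr_flip)
  finally show ?thesis .
qed

end

section \<open>The canonical connection of a W3-manifold\<close>

text \<open>Uniqueness of the canonical connection, in algebraic form: \<open>u\<close> is the difference of two solutions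
of the torsion condition, so it is skew and commutes with \<open>P\<close>.  The sum \<open>v\<close> is twice the part
of \<open>u\<close> whose first two arguments lie in the same eigenspace of \<open>P\<close>; since \<open>u\<close> commutes with \<open>P\<close>,
all three arguments then do.  The condition expresses \<open>u\<close> by \<open>v\<close>, and for \<open>v\<close> it is a
relation between cyclic rotations that only 0 satisfies.\<close>
lemma potential_unique:
  fixes u :: "'a \<Rightarrow> 'a \<Rightarrow> 'a \<Rightarrow> real"
  assumes P: "\<And>x. x \<in> S \<Longrightarrow> P x \<in> S" "\<And>x. x \<in> S \<Longrightarrow> P (P x) = x"
    and skew: "\<And>x y z. x \<in> S \<Longrightarrow> y \<in> S \<Longrightarrow> z \<in> S \<Longrightarrow> u x y z = - u x z y"
    and inv: "\<And>x y z. x \<in> S \<Longrightarrow> y \<in> S \<Longrightarrow> z \<in> S \<Longrightarrow> u x (P y) (P z) = u x y z"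
    and canonical: "\<And>x y z. x \<in> S \<Longrightarrow> y \<in> S \<Longrightarrow> z \<in> S \<Longrightarrow>
      u x y z - u y x z + (u y z x - u z y x) + (u (P x) y (P z) - u y (P x) (P z))
      + (u y (P z) (P x) - u (P z) y (P x)) = 0"
    and xyz: "x \<in> S" "y \<in> S" "z \<in> S"
  shows "u x y z = 0"
proof -
  define v where "v = (\<lambda>x y z. u x y z + u (P x) (P y) z)"
  have inv': "u x y (P z) = u x (P y) z" if "x \<in> S" "y \<in> S" "z \<in> S" for x y z
    using inv[of x y "P z"] that P by simp
  have vskew: "v x z y = - v x y z" if "x \<in> S" "y \<in> S" "z \<in> S" for x y z
    using skew[of x z y] skew[of "P x" "P z" y] inv'[of "P x" y z] that P
    by (simp add: v_def)
  have vinv: "v (P x) (P y) z = v x y z" if "x \<in> S" "y \<in> S" "z \<in> S" for x y z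
    using that P by (simp add: v_def)
  have vinv2: "v z (P x) (P y) = v z x y" if "x \<in> S" "y \<in> S" "z \<in> S" for x y z
    using that P inv[of z x y] inv[of "P z" "P x" y] inv'[of "P z" x y] by (simp add: v_def)
  have uv: "4 * u y x z = v x y z + v z x y" if "x \<in> S" "y \<in> S" "z \<in> S" for x y z
    using canonical[of x y z] skew[of y z x] inv[of y x z] inv[of y z x]
      inv'[of "P x" y z] inv'[of "P z" y x] vskew[of z x y] that P
    by (simp add: v_def)
  have "4 * v y x z = 2 * (v x y z + v z x y)" if "x \<in> S" "y \<in> S" "z \<in> S" for x y z
    using uv[of x y z] uv[of "P x" "P y" z] vinv[of x y z] vinv2[of x y z] that P
    by (simp add: v_def)
  then have cyclic: "- 2 * v y z x = v x y z + v z x y" if "x \<in> S" "y \<in> S" "z \<in> S" for x y z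
    using vskew[of y z x] that by fastforce
  \<comment> \<open>Each value of \<open>v\<close> on a cyclic rotation is minus the sum over the rotations, so that sum
    is minus three times itself.\<close>
  then have "v x y z = 0" if "x \<in> S" "y \<in> S" "z \<in> S" for x y z
    using cyclic[OF that] cyclic[OF that(2,3,1)] cyclic[OF that(3,1,2)] by argo
  then show ?thesis using uv[of y x z] xyz by simp
qed

text \<open>The right-hand side is a natural potential satisfying the torsion condition, so it is \<open>q\<close> by
\<open>potential_unique\<close>.  Here \<open>q\<close> and \<open>F\<close> are the covariant forms of the difference tensor and of the
derivative of \<open>P\<close>.  The summand \<open>F x y (P z) / 2\<close> alone already makes the connection preserve \<open>P\<close>; the
other summand commutes with \<open>P\<close> and adjusts the torsion.  The cyclic identity is what makes that other
summand skew in \<open>y\<close> and \<open>z\<close>.\<close>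
lemma canonical_potential:
  fixes q F :: "'a \<Rightarrow> 'a \<Rightarrow> 'a \<Rightarrow> real"
  assumes P: "\<And>x. x \<in> S \<Longrightarrow> P x \<in> S" "\<And>x. x \<in> S \<Longrightarrow> P (P x) = x"
    and Fsym: "\<And>x y z. x \<in> S \<Longrightarrow> y \<in> S \<Longrightarrow> z \<in> S \<Longrightarrow> F x z y = F x y z"
    and FP: "\<And>x y z. x \<in> S \<Longrightarrow> y \<in> S \<Longrightarrow> z \<in> S \<Longrightarrow> F x (P y) z = - F x y (P z)"
    and cyc: "\<And>x y z. x \<in> S \<Longrightarrow> y \<in> S \<Longrightarrow> z \<in> S \<Longrightarrow> F x y z + F y z x + F z x y = 0"
    and skew: "\<And>x y z. x \<in> S \<Longrightarrow> y \<in> S \<Longrightarrow> z \<in> S \<Longrightarrow> q x y z = - q x z y"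
    and natural: "\<And>x y z. x \<in> S \<Longrightarrow> y \<in> S \<Longrightarrow> z \<in> S \<Longrightarrow> q x (P y) (P z) = q x y z - F x y (P z)"
    and canonical: "\<And>x y z. x \<in> S \<Longrightarrow> y \<in> S \<Longrightarrow> z \<in> S \<Longrightarrow>
      q x y z - q y x z + (q y z x - q z y x) + (q (P x) y (P z) - q y (P x) (P z))
      + (q y (P z) (P x) - q (P z) y (P x)) = 0"
    and xyz: "x \<in> S" "y \<in> S" "z \<in> S"
  shows "q x y z = F x y (P z) / 2 + (F y x (P z) + F (P y) x z) / 4"
proof -
  define f where "f = (\<lambda>x y z. F x y (P z) / 2 + (F y x (P z) + F (P y) x z) / 4)"
  \<comment> \<open>Rules that move every \<open>P\<close> out of the second argument of \<open>F\<close> and order the last two arguments.\<close>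
  have N: "F a c b = F a b c" "F a c (P b) = - F a b (P c)" "F a (P c) b = F a b (P c)"
    "F a (P b) c = - F a b (P c)" "F a (P c) (P b) = - F a b c" "F a (P b) (P c) = - F a b c"
    if "a \<in> S" "b \<in> S" "c \<in> S" for a b c
  proof -
    note S = that and PS = P(1)[OF that(1)] P(1)[OF that(2)] P(1)[OF that(3)]
    show 1: "F a c b = F a b c" by (rule Fsym[OF S])
    show 4: "F a (P b) c = - F a b (P c)" by (rule FP[OF S])
    show "F a c (P b) = - F a b (P c)" using Fsym[OF S(1) PS(2) S(3)] 4 by simp
    show "F a (P c) b = F a b (P c)" by (rule Fsym[OF S(1,2) PS(3)])
    show "F a (P b) (P c) = - F a b c" using FP[OF S(1,2) PS(3)] P(2)[OF S(3)] by simp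
    then show "F a (P c) (P b) = - F a b c" using Fsym[OF S(1) PS(2) PS(3)] by simp
  qed
  have "(\<lambda>x y z. q x y z - f x y z) x y z = 0"
  proof (rule potential_unique[where S = S and P = P])
    fix x y z assume S: "x \<in> S" "y \<in> S" "z \<in> S"
    note PS = P(1)[OF S(1)] P(1)[OF S(2)] P(1)[OF S(3)] and PP = P(2)[OF S(1)] P(2)[OF S(2)] P(2)[OF S(3)]
    show "q x y z - f x y z = - (q x z y - f x z y)"
      using skew[OF S] cyc[OF S(1) PS(2) S(3)] cyc[OF S(1,2) PS(3)] N(2)[OF S] N(4)[OF S]
        N(1)[OF PS(2) S(1,3)] N(3)[OF S(2,1,3)]
      unfolding f_def by argo
    show "q x (P y) (P z) - f x (P y) (P z) = q x y z - f x y z"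
      using natural[OF S] N(4)[OF S] unfolding f_def PP by argo
    show "q x y z - f x y z - (q y x z - f y x z) + (q y z x - f y z x - (q z y x - f z y x)) +
       (q (P x) y (P z) - f (P x) y (P z) - (q y (P x) (P z) - f y (P x) (P z))) +
       (q y (P z) (P x) - f y (P z) (P x) - (q (P z) y (P x) - f (P z) y (P x))) = 0"
      using canonical[OF S] N(2,3,4)[OF S(2,1,3)] N(1,5,6)[OF PS(2) S(1,3)]
      unfolding f_def PP by argo
  qed (simp_all add: P xyz)
  then show ?thesis by (simp add: f_def)
qed

lemma linear_connectionD:
  assumes "linear_connection A D"
  shows "X \<in> vector_fields A \<Longrightarrow> Y \<in> vector_fields A \<Longrightarrow> D X Y \<in> vector_fields A"
    and "X \<in> vector_fields A \<Longrightarrow> Y \<in> vector_fields A \<Longrightarrow> Z \<in> vector_fields A \<Longrightarrow> D (X + Y) Z = D X Z + D Y Z"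
    and "X \<in> vector_fields A \<Longrightarrow> Y \<in> vector_fields A \<Longrightarrow> Z \<in> vector_fields A \<Longrightarrow> D X (Y + Z) = D X Y + D X Z"
    and "f \<in> smooth_functions A \<Longrightarrow> X \<in> vector_fields A \<Longrightarrow> Y \<in> vector_fields A \<Longrightarrow> D (fscale f X) Y = fscale f (D X Y)"
    and "f \<in> smooth_functions A \<Longrightarrow> X \<in> vector_fields A \<Longrightarrow> Y \<in> vector_fields A \<Longrightarrow>
      D X (fscale f Y) = fscale (X f) Y + fscale f (D X Y)"
  using assms unfolding linear_connection_def by simp_all

lemma fscale_diff: "fscale f (X - Y) = fscale f X - fscale f Y"
  by (intro ext) (simp add: fscale_def algebra_simps)

lemma fscale_add: "fscale f (X + Y) = fscale f X + fscale f Y"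
  by (intro ext) (simp add: fscale_def algebra_simps)

locale W3_canonical = riemannian_manifold A g
  for A :: "('m::{t2_space, second_countable_topology}, 'n::finite) atlas"
    and g :: "'m vfield \<Rightarrow> 'm vfield \<Rightarrow> 'm \<Rightarrow> real" +
  fixes P :: "'m vfield \<Rightarrow> 'm vfield" and D D' :: "'m connection"
  assumes P_tensor: "tensor_field_1_1 A P"
    and P_P: "\<And>X. X \<in> VF \<Longrightarrow> P (P X) = X"
    and P_isometry: "\<And>X Y. X \<in> VF \<Longrightarrow> Y \<in> VF \<Longrightarrow> g (P X) (P Y) = g X Y"
    and levi_civita: "levi_civita A g D"
    and canonical: "canonical_connection A P g D'"
    and W3: "\<And>X Y Z. X \<in> VF \<Longrightarrow> Y \<in> VF \<Longrightarrow> Z \<in> VF \<Longrightarrow>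
      g (deriv_P D P X Y) Z + g (deriv_P D P Y Z) X + g (deriv_P D P Z X) Y = 0"
begin

definition dP :: "'m vfield \<Rightarrow> 'm vfield \<Rightarrow> 'm vfield" where
  "dP X Y = deriv_P D P X Y"

definition Q :: "'m vfield \<Rightarrow> 'm vfield \<Rightarrow> 'm vfield" where
  "Q X Y = D' X Y - D X Y"

lemma D_connection: "linear_connection A D" and D'_connection: "linear_connection A D'"
  using levi_civita canonical
  unfolding levi_civita_def canonical_connection_def natural_connection_def by simp_all

lemmas D_rules = linear_connectionD[OF D_connection] and D'_rules = linear_connectionD[OF D'_connection]

lemma P_rules:
  "X \<in> VF \<Longrightarrow> P X \<in> VF" "X \<in> VF \<Longrightarrow> Y \<in> VF \<Longrightarrow> P (X + Y) = P X + P Y"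
  "f \<in> SF \<Longrightarrow> X \<in> VF \<Longrightarrow> P (fscale f X) = fscale f (P X)"
  using P_tensor unfolding tensor_field_1_1_def by simp_all

declare D_rules(1) [simp] D'_rules(1) [simp] P_rules(1) [simp] P_P [simp]

lemma P_diff: "X \<in> VF \<Longrightarrow> Y \<in> VF \<Longrightarrow> P (X - Y) = P X - P Y"
  using additive_diff[OF manifold, of P] P_rules by simp

lemma D'_diff_right: "X \<in> VF \<Longrightarrow> Y \<in> VF \<Longrightarrow> Z \<in> VF \<Longrightarrow> D' X (Y - Z) = D' X Y - D' X Z"
  using additive_diff[OF manifold, of "D' X"] D'_rules by simp

lemma dP_VF [simp]: "X \<in> VF \<Longrightarrow> Y \<in> VF \<Longrightarrow> dP X Y \<in> VF"
  by (simp add: dP_def deriv_P_def)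

lemma Q_VF [simp]: "X \<in> VF \<Longrightarrow> Y \<in> VF \<Longrightarrow> Q X Y \<in> VF"
  by (simp add: Q_def)

lemma dP_tensor:
  "X \<in> VF \<Longrightarrow> tensor_field_1_1 A (dP X)"
  "Y \<in> VF \<Longrightarrow> tensor_field_1_1 A (\<lambda>X. dP X Y)"
  unfolding tensor_field_1_1_def dP_def deriv_P_def
  by (auto simp: D_rules P_rules P_diff fscale_diff algebra_simps)

lemma Q_tensor:
  "X \<in> VF \<Longrightarrow> tensor_field_1_1 A (Q X)"
  "Y \<in> VF \<Longrightarrow> tensor_field_1_1 A (\<lambda>X. Q X Y)"
  unfolding tensor_field_1_1_def Q_def
  by (auto simp: D_rules D'_rules fscale_diff algebra_simps)

lemma tensor_comp:
  "tensor_field_1_1 A L \<Longrightarrow> tensor_field_1_1 A L' \<Longrightarrow> tensor_field_1_1 A (\<lambda>X. L (L' X))"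
  unfolding tensor_field_1_1_def by simp

lemma P_self_adjoint: "X \<in> VF \<Longrightarrow> Y \<in> VF \<Longrightarrow> g (P X) Y = g X (P Y)"
  using P_isometry[of X "P Y"] by simp

text \<open>Differentiating \<open>P\<^sup>2 = 1\<close> gives \<open>dP X (P Y) = - P (dP X Y)\<close>.  The scalar form leaves sums of
such terms to real arithmetic.\<close>
lemma dP_P: "X \<in> VF \<Longrightarrow> Y \<in> VF \<Longrightarrow> Z \<in> VF \<Longrightarrow> g (dP X (P Y)) Z p = - g (dP X Y) (P Z) p"
  by (simp add: P_self_adjoint[symmetric] dP_def deriv_P_def P_diff metric_linear)

lemma connection_metric:
  assumes "X \<in> VF" "Y \<in> VF" "Z \<in> VF"
  shows "X (g Y Z) p = g (D X Y) Z p + g Y (D X Z) p"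
    and "X (g Y Z) p = g (D' X Y) Z p + g Y (D' X Z) p"
proof -
  have "deriv_g D g X Y Z = 0" "deriv_g D' g X Y Z = 0"
    using levi_civita canonical assms
    unfolding levi_civita_def canonical_connection_def natural_connection_def by simp_all
  from fun_cong[OF this(1), of p] fun_cong[OF this(2), of p]
  show "X (g Y Z) p = g (D X Y) Z p + g Y (D X Z) p"
    and "X (g Y Z) p = g (D' X Y) Z p + g Y (D' X Z) p"
    unfolding deriv_g_def by simp_all
qed

lemma dP_self_adjoint:
  assumes "X \<in> VF" "Y \<in> VF" "Z \<in> VF"
  shows "g (dP X Y) Z p = g Y (dP X Z) p"
  using connection_metric(1)[of X "P Y" Z p] connection_metric(1)[of X Y "P Z" p]
    P_self_adjoint[of Y Z] P_self_adjoint[of "D X Y" Z] P_self_adjoint[of Y "D X Z"] assms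
  by (simp add: dP_def deriv_P_def metric_linear)

lemma Q_skew:
  assumes "X \<in> VF" "Y \<in> VF" "Z \<in> VF"
  shows "g (Q X Y) Z p = - g Y (Q X Z) p"
  using connection_metric[of X Y Z p] assms by (simp add: Q_def metric_linear)

lemma D'_P: "X \<in> VF \<Longrightarrow> Y \<in> VF \<Longrightarrow> D' X (P Y) = P (D' X Y)"
proof -
  assume "X \<in> VF" "Y \<in> VF"
  then have "deriv_P D' P X Y = 0"
    using canonical unfolding canonical_connection_def natural_connection_def by simp
  then show ?thesis unfolding deriv_P_def by simp
qed

lemma bracket_eq: "X \<in> VF \<Longrightarrow> Y \<in> VF \<Longrightarrow> bracket X Y = D X Y - D Y X"
proof -
  assume "X \<in> VF" "Y \<in> VF"
  then have "torsion D X Y = 0" using levi_civita unfolding levi_civita_def by simp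
  then show ?thesis unfolding torsion_def by (simp add: algebra_simps)
qed

lemma torsion_eq: "X \<in> VF \<Longrightarrow> Y \<in> VF \<Longrightarrow> torsion D' X Y = Q X Y - Q Y X"
  by (simp add: torsion_def bracket_eq Q_def)

lemma Q_formula:
  assumes X: "X \<in> VF" and Y: "Y \<in> VF" and Z: "Z \<in> VF"
  shows "g (Q X Y) Z p = g (dP X Y) (P Z) p / 2 + (g (dP Y X) (P Z) p + g (dP (P Y) X) Z p) / 4"
proof (rule canonical_potential[where q = "\<lambda>X Y Z. g (Q X Y) Z p" and F = "\<lambda>X Y Z. g (dP X Y) Z p" and P = P and S = VF])
  fix X Y Z assume V [simp]: "X \<in> VF" "Y \<in> VF" "Z \<in> VF"
  show "g (dP X Z) Y p = g (dP X Y) Z p"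
    using dP_self_adjoint[OF V(1,2,3), of p] metric_sym[of Y "dP X Z"] by simp
  show "g (dP X (P Y)) Z p = - g (dP X Y) (P Z) p" by (rule dP_P) simp_all
  show "g (dP X Y) Z p + g (dP Y Z) X p + g (dP Z X) Y p = 0"
    using fun_cong[OF W3[OF V], of p] unfolding dP_def by simp
  show "g (Q X Y) Z p = - g (Q X Z) Y p"
    using Q_skew[OF V, of p] metric_sym[of Y "Q X Z"] by simp
  show "g (Q X (P Y)) (P Z) p = g (Q X Y) Z p - g (dP X Y) (P Z) p"
    using P_isometry[of "D X Y" Z] P_isometry[of "D' X Y" Z]
    by (simp add: Q_def dP_def deriv_P_def D'_P metric_linear)
  have "g (torsion D' X Y) Z + g (torsion D' Y Z) X +
      g (torsion D' (P X) Y) (P Z) + g (torsion D' Y (P Z)) (P X) = 0"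
    using canonical unfolding canonical_connection_def by simp
  from fun_cong[OF this, of p]
  show "g (Q X Y) Z p - g (Q Y X) Z p + (g (Q Y Z) X p - g (Q Z Y) X p) +
       (g (Q (P X) Y) (P Z) p - g (Q Y (P X)) (P Z) p) + (g (Q Y (P Z)) (P X) p - g (Q (P Z) Y) (P X) p) = 0"
    by (simp add: torsion_eq metric_linear)
qed (use X Y Z in simp_all)

text \<open>Add the cyclic identities for \<open>X, Y, Z\<close> and for \<open>P X, P Y, Z\<close>.  The terms differentiated along \<open>Z\<close>
cancel, because \<open>dP Z\<close> anticommutes with the isometry \<open>P\<close>.\<close>
lemma W3_sym:
  assumes V [simp]: "X \<in> VF" "Y \<in> VF" "Z \<in> VF"
  shows "g (dP X Y) Z p + g (dP Y X) Z p = g (dP (P X) Y) (P Z) p + g (dP (P Y) X) (P Z) p"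
proof -
  have "g (dP X Y) Z p + g (dP Y Z) X p + g (dP Z X) Y p = 0"
    using fun_cong[OF W3[OF V], of p] unfolding dP_def by simp
  moreover have "g (dP (P X) (P Y)) Z p + g (dP (P Y) Z) (P X) p + g (dP Z (P X)) (P Y) p = 0"
    using fun_cong[OF W3[of "P X" "P Y" Z], of p] unfolding dP_def by simp
  moreover have "g (dP Y Z) X p = g (dP Y X) Z p" "g (dP (P Y) Z) (P X) p = g (dP (P Y) (P X)) Z p"
    using dP_self_adjoint[of Y Z X p] dP_self_adjoint[of "P Y" Z "P X" p]
      metric_sym[of Z "dP Y X"] metric_sym[of Z "dP (P Y) (P X)"] by simp_all
  moreover have "g (dP (P X) (P Y)) Z p = - g (dP (P X) Y) (P Z) p"
    "g (dP (P Y) (P X)) Z p = - g (dP (P Y) X) (P Z) p" "g (dP Z (P X)) (P Y) p = - g (dP Z X) Y p"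
    by (simp_all add: dP_P)
  ultimately show ?thesis by linarith
qed

text \<open>By \<open>Q_formula\<close> and \<open>W3_sym\<close> the symmetric part of \<open>Q\<close> is \<open>P (dP X Y + dP Y X)\<close>, and \<open>W3_sym\<close>
says that \<open>dP X Y + dP Y X\<close> vanishes when \<open>X\<close> and \<open>Y\<close> lie in the same eigenbundle of \<open>P\<close>.\<close>
lemma Q_sym_anti:
  assumes V [simp]: "X \<in> VF" "Y \<in> VF"
  shows "Q (P X) (P Y) + Q (P Y) (P X) + Q X Y + Q Y X = 0"
proof (rule metric_nondegenerate)
  fix Z p assume Z [simp]: "Z \<in> VF"
  show "g (Q (P X) (P Y) + Q (P Y) (P X) + Q X Y + Q Y X) Z p = 0"
    using W3_sym[of X Y "P Z" p]
    by (simp add: metric_add_left Q_formula dP_P) argo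
qed simp

section \<open>Traces of the difference tensor\<close>

text \<open>The covariant derivative \<open>(D'\<^sub>X Q)(Y, Z)\<close>.  The connection \<open>D'\<close> is used instead of \<open>D\<close> because \<open>P\<close> is
parallel for it, so that identities between \<open>Q\<close> and \<open>P\<close> can be differentiated.\<close>
definition DQ :: "'m vfield \<Rightarrow> 'm vfield \<Rightarrow> 'm vfield \<Rightarrow> 'm vfield" where
  "DQ X Y Z = D' X (Q Y Z) - Q (D' X Y) Z - Q Y (D' X Z)"

lemma DQ_VF [simp]: "X \<in> VF \<Longrightarrow> Y \<in> VF \<Longrightarrow> Z \<in> VF \<Longrightarrow> DQ X Y Z \<in> VF"
  by (simp add: DQ_def)

lemma Q_rules:
  "X \<in> VF \<Longrightarrow> Y \<in> VF \<Longrightarrow> Z \<in> VF \<Longrightarrow> Q (X + Y) Z = Q X Z + Q Y Z"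
  "X \<in> VF \<Longrightarrow> Y \<in> VF \<Longrightarrow> Z \<in> VF \<Longrightarrow> Q X (Y + Z) = Q X Y + Q X Z"
  "f \<in> SF \<Longrightarrow> X \<in> VF \<Longrightarrow> Y \<in> VF \<Longrightarrow> Q (fscale f X) Y = fscale f (Q X Y)"
  "f \<in> SF \<Longrightarrow> X \<in> VF \<Longrightarrow> Y \<in> VF \<Longrightarrow> Q X (fscale f Y) = fscale f (Q X Y)"
  using Q_tensor unfolding tensor_field_1_1_def by simp_all

lemma Q_diff:
  "X \<in> VF \<Longrightarrow> Y \<in> VF \<Longrightarrow> Z \<in> VF \<Longrightarrow> Q (X - Y) Z = Q X Z - Q Y Z"
  "X \<in> VF \<Longrightarrow> Y \<in> VF \<Longrightarrow> Z \<in> VF \<Longrightarrow> Q X (Y - Z) = Q X Y - Q X Z"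
  using additive_diff[OF manifold, of "\<lambda>X. Q X Z"] additive_diff[OF manifold, of "Q X"] Q_rules by simp_all

lemma DQ_tensor:
  "X \<in> VF \<Longrightarrow> Y \<in> VF \<Longrightarrow> tensor_field_1_1 A (DQ X Y)"
  "X \<in> VF \<Longrightarrow> Z \<in> VF \<Longrightarrow> tensor_field_1_1 A (\<lambda>Y. DQ X Y Z)"
  unfolding tensor_field_1_1_def DQ_def
  by (auto simp: D'_rules Q_rules fscale_diff fscale_add algebra_simps)

text \<open>Apply \<open>D' X\<close> to \<open>Q_sym_anti\<close> and subtract \<open>Q_sym_anti\<close> for the pairs \<open>D' X Y, Z\<close> and \<open>Y, D' X Z\<close>.\<close>
lemma DQ_sym_anti:
  assumes V [simp]: "X \<in> VF" "Y \<in> VF" "Z \<in> VF"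
  shows "DQ X (P Y) (P Z) + DQ X (P Z) (P Y) + DQ X Y Z + DQ X Z Y = 0"
proof -
  have "D' X (Q (P Y) (P Z) + Q (P Z) (P Y) + Q Y Z + Q Z Y) =
    (Q (P (D' X Y)) (P Z) + Q (P Z) (P (D' X Y)) + Q (D' X Y) Z + Q Z (D' X Y)) +
    (Q (P Y) (P (D' X Z)) + Q (P (D' X Z)) (P Y) + Q Y (D' X Z) + Q (D' X Z) Y)"
  proof -
    have "D' X 0 = 0" using D'_diff_right[of X X X] by simp
    then show ?thesis by (simp add: Q_sym_anti)
  qed
  then show ?thesis
    by (simp add: DQ_def D'_P D'_rules(3) algebra_simps)
qed

lemma tr_P:
  assumes "\<And>Y. Y \<in> VF \<Longrightarrow> tensorial A (\<lambda>X. B X Y)" "\<And>X. X \<in> VF \<Longrightarrow> tensorial A (\<lambda>Y. B X Y)"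
  shows "tr p (\<lambda>X Y. B (P X) (P Y) p) = tr p (\<lambda>X Y. B X Y p)"
proof -
  have "tensorial A (\<lambda>Y. B X (P Y))" if "X \<in> VF" for X
    using assms(2)[OF that] unfolding tensorial_def by (simp add: P_rules)
  then have "tr p (\<lambda>X Y. B (P X) (P Y) p) = tr p (\<lambda>X Y. B X (P (P Y)) p)"
    by (intro tr_adjoint[OF P_tensor, of "\<lambda>X Y. B X (P Y)"] P_self_adjoint assms) simp_all
  also have "\<dots> = tr p (\<lambda>X Y. B X Y p)" by (rule tr_cong) simp
  finally show ?thesis .
qed

text \<open>Neither applying the orthogonal map \<open>P\<close> to both arguments nor exchanging them changes the trace, so the
four terms in the last assumption have the same trace.\<close>
lemma tr_zero:
  assumes "\<And>Y. Y \<in> VF \<Longrightarrow> tensorial A (\<lambda>X. B X Y)" "\<And>X. X \<in> VF \<Longrightarrow> tensorial A (\<lambda>Y. B X Y)"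
    and "\<And>X Y. X \<in> VF \<Longrightarrow> Y \<in> VF \<Longrightarrow> B (P X) (P Y) p + B (P Y) (P X) p + B X Y p + B Y X p = 0"
  shows "tr p (\<lambda>X Y. B X Y p) = 0"
proof -
  have "tr p (\<lambda>X Y. B (P X) (P Y) p + B (P Y) (P X) p + B X Y p + B Y X p) = tr p (\<lambda>X Y. 0)"
    by (rule tr_cong) (rule assms(3))
  moreover have "tr p (\<lambda>X Y. B (P Y) (P X) p) = tr p (\<lambda>X Y. B (P X) (P Y) p)"
    "tr p (\<lambda>X Y. B Y X p) = tr p (\<lambda>X Y. B X Y p)"
    by (rule tr_flip)+
  moreover have "tr p (\<lambda>X Y. 0) = 0" by (simp add: metric_trace_def)
  ultimately show ?thesis using tr_P[OF assms(1,2)] by (simp add: tr_add)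
qed

lemma tr_DQ: "X \<in> VF \<Longrightarrow> V \<in> VF \<Longrightarrow> tr p (\<lambda>Y Z. g (DQ X Y Z) V p) = 0"
proof (rule tr_zero)
  fix Y Z assume [simp]: "X \<in> VF" "V \<in> VF" "Y \<in> VF" "Z \<in> VF"
  have "g (DQ X (P Y) (P Z) + DQ X (P Z) (P Y) + DQ X Y Z + DQ X Z Y) V p = g 0 V p"
    by (subst DQ_sym_anti) simp_all
  then show "g (DQ X (P Y) (P Z)) V p + g (DQ X (P Z) (P Y)) V p + g (DQ X Y Z) V p + g (DQ X Z Y) V p = 0"
    by (simp add: metric_add_left metric_zero_left)
qed (auto intro: tensorial_metric DQ_tensor)

lemma tr_Q: "V \<in> VF \<Longrightarrow> tr p (\<lambda>Y Z. g (Q Y Z) V p) = 0"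
proof (rule tr_zero)
  fix Y Z assume [simp]: "V \<in> VF" "Y \<in> VF" "Z \<in> VF"
  have "g (Q (P Y) (P Z) + Q (P Z) (P Y) + Q Y Z + Q Z Y) V p = g 0 V p"
    by (subst Q_sym_anti) simp_all
  then show "g (Q (P Y) (P Z)) V p + g (Q (P Z) (P Y)) V p + g (Q Y Z) V p + g (Q Z Y) V p = 0"
    by (simp add: metric_add_left metric_zero_left)
qed (auto intro: tensorial_metric Q_tensor)

lemma DQ_skew:
  assumes V [simp]: "Y \<in> VF" "X \<in> VF" "Z \<in> VF" "W \<in> VF"
  shows "g (DQ Y X Z) W p = - g (DQ Y X W) Z p"
proof -
  have "g (Q X Z) W = (\<lambda>q. -1 * g (Q X W) Z q)"
    using Q_skew[of X Z W] metric_sym[of Z "Q X W"] by (simp add: fun_eq_iff)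
  then have "Y (g (Q X Z) W) = (\<lambda>q. -1 * Y (g (Q X W) Z) q)"
    by (simp only:) (rule vector_fieldsD(3)[OF V(1)], simp)
  then have "Y (g (Q X Z) W) p = - Y (g (Q X W) Z) p" by simp
  then show ?thesis
    using connection_metric(2)[of Y "Q X Z" W p] connection_metric(2)[of Y "Q X W" Z p]
      Q_skew[of "D' Y X" Z W p] Q_skew[of X "D' Y Z" W p] Q_skew[of X Z "D' Y W" p]
      metric_sym[of Z "Q (D' Y X) W"] metric_sym[of "D' Y Z" "Q X W"] metric_sym[of Z "Q X (D' Y W)"]
    by (simp add: DQ_def metric_diff_left)
qed

section \<open>The difference of the scalar curvatures\<close>

text \<open>Substitute \<open>D = D' - Q\<close> in the curvature of \<open>D\<close>.  The bracket is expressed by \<open>D'\<close> and its torsion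
\<open>Q X Y - Q Y X\<close>, which is where the terms \<open>Q (Q X Y) Z\<close> come from.\<close>
lemma curvature_difference:
  assumes V [simp]: "X \<in> VF" "Y \<in> VF" "Z \<in> VF" "W \<in> VF"
  shows "g (curvature D X Y Z) W p = g (curvature D' X Y Z) W p
    - g (DQ X Y Z) W p + g (DQ Y X Z) W p
    - (g (Q (Q X Y) Z) W p - g (Q (Q Y X) Z) W p)
    + (g (Q X (Q Y Z)) W p - g (Q Y (Q X Z)) W p)"
proof -
  have D: "D U V = D' U V - Q U V" for U V by (simp add: Q_def)
  have b: "bracket X Y = (D' X Y - Q X Y) - (D' Y X - Q Y X)"
    by (simp add: bracket_eq Q_def)
  have [simp]: "bracket X Y \<in> VF" by (simp add: b)
  have "Q (bracket X Y) Z = (Q (D' X Y) Z - Q (Q X Y) Z) - (Q (D' Y X) Z - Q (Q Y X) Z)"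
    by (simp add: b Q_diff)
  then show ?thesis
    unfolding curvature_def D[of X "D' Y Z - Q Y Z"] D[of Y "D' X Z - Q X Z"] D[of "bracket X Y" Z] D[of Y Z] D[of X Z]
    by (simp add: DQ_def D'_diff_right Q_diff metric_diff_left)
qed

text \<open>In an orthonormal basis, \<open>\<Sum> g (Q e\<^sub>i e\<^sub>k) (Q e\<^sub>k e\<^sub>i)\<close>.\<close>
definition tr_QQ :: "'m \<Rightarrow> real" where
  "tr_QQ p = tr p (\<lambda>X W. tr p (\<lambda>Y Z. g (Q X Z) (Q Y W) p))"

text \<open>Expand \<open>Q X Y\<close> in the basis, use that \<open>Q X\<close> is skew to free \<open>Y\<close>, and contract the pair \<open>Y, Z\<close>; skewness
once more turns the result into \<open>tr_QQ\<close>.\<close>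
lemma tr_Q_Q_left:
  "tr p (\<lambda>Y Z. tr p (\<lambda>X W. g (Q (Q X Y) Z) W p)) = tr_QQ p"
proof -
  have "tr p (\<lambda>Y Z. tr p (\<lambda>X W. g (Q (Q X Y) Z) W p)) =
      tr p (\<lambda>Y Z. tr p (\<lambda>X W. tr p (\<lambda>a b. g (Q X Y) a p * g (Q b Z) W p)))"
  proof (intro tr_cong)
    fix X Y Z W assume [simp]: "X \<in> VF" "Y \<in> VF" "Z \<in> VF" "W \<in> VF"
    show "g (Q (Q X Y) Z) W p = tr p (\<lambda>a b. g (Q X Y) a p * g (Q b Z) W p)"
      by (rule tr_contract[where \<beta> = "\<lambda>b. g (Q b Z) W", symmetric])
        (simp_all add: tensorial_metric Q_tensor)
  qed
  also have "\<dots> = tr p (\<lambda>X W. tr p (\<lambda>Y Z. tr p (\<lambda>a b. g (Q X Y) a p * g (Q b Z) W p)))"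
    by (rule tr_swap)
  also have "\<dots> = tr p (\<lambda>X W. tr p (\<lambda>a b. tr p (\<lambda>Y Z. g (Q X Y) a p * g (Q b Z) W p)))"
    by (rule tr_cong) (rule tr_swap)
  also have "\<dots> = tr p (\<lambda>X W. tr p (\<lambda>a b. - tr p (\<lambda>Y Z. g (Q X a) Y p * g (Q b Z) W p)))"
  proof (intro tr_cong)
    fix X W a b assume [simp]: "X \<in> VF" "W \<in> VF" "a \<in> VF" "b \<in> VF"
    have "g (Q X Y) a p * g (Q b Z) W p = - (g (Q X a) Y p * g (Q b Z) W p)" if "Y \<in> VF" for Y Z
      using Q_skew[of X Y a p] metric_sym[of Y "Q X a"] that by simp
    then show "tr p (\<lambda>Y Z. g (Q X Y) a p * g (Q b Z) W p) = - tr p (\<lambda>Y Z. g (Q X a) Y p * g (Q b Z) W p)"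
      unfolding tr_minus[symmetric] by (intro tr_cong) simp
  qed
  also have "\<dots> = tr p (\<lambda>X W. tr p (\<lambda>a b. g (Q X a) (Q b W) p))"
  proof (intro tr_cong)
    fix X W a b assume [simp]: "X \<in> VF" "W \<in> VF" "a \<in> VF" "b \<in> VF"
    have "tr p (\<lambda>Y Z. g (Q X a) Y p * g (Q b Z) W p) = g (Q b (Q X a)) W p"
      by (rule tr_contract[where \<beta> = "\<lambda>Z. g (Q b Z) W"]) (simp_all add: tensorial_metric Q_tensor)
    then show "- tr p (\<lambda>Y Z. g (Q X a) Y p * g (Q b Z) W p) = g (Q X a) (Q b W) p"
      using Q_skew[of b "Q X a" W p] by simp
  qed
  also have "\<dots> = tr_QQ p" unfolding tr_QQ_def
    by (rule tr_cong) (rule tr_flip)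
  finally show ?thesis .
qed

text \<open>The argument of \<open>tr_Q_Q_left\<close> with \<open>Q Y\<close> in place of \<open>Q X\<close>, contracting the pair \<open>X, W\<close> instead; here
skewness is used only once, which accounts for the sign.\<close>
lemma tr_Q_Q_right:
  "tr p (\<lambda>Y Z. tr p (\<lambda>X W. g (Q (Q Y X) Z) W p)) = - tr_QQ p"
proof -
  have "tr p (\<lambda>Y Z. tr p (\<lambda>X W. g (Q (Q Y X) Z) W p)) =
      tr p (\<lambda>Y Z. tr p (\<lambda>X W. tr p (\<lambda>a b. g (Q Y X) a p * g (Q b Z) W p)))"
  proof (intro tr_cong)
    fix X Y Z W assume [simp]: "X \<in> VF" "Y \<in> VF" "Z \<in> VF" "W \<in> VF"
    show "g (Q (Q Y X) Z) W p = tr p (\<lambda>a b. g (Q Y X) a p * g (Q b Z) W p)"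
      by (rule tr_contract[where \<beta> = "\<lambda>b. g (Q b Z) W", symmetric])
        (simp_all add: tensorial_metric Q_tensor)
  qed
  also have "\<dots> = tr p (\<lambda>Y Z. tr p (\<lambda>a b. tr p (\<lambda>X W. g (Q Y X) a p * g (Q b Z) W p)))"
    by (rule tr_cong) (rule tr_swap)
  also have "\<dots> = tr p (\<lambda>Y Z. tr p (\<lambda>a b. - tr p (\<lambda>X W. g (Q Y a) X p * g (Q b Z) W p)))"
  proof (intro tr_cong)
    fix Y Z a b assume [simp]: "Y \<in> VF" "Z \<in> VF" "a \<in> VF" "b \<in> VF"
    have "g (Q Y X) a p * g (Q b Z) W p = - (g (Q Y a) X p * g (Q b Z) W p)" if "X \<in> VF" for X W
      using Q_skew[of Y X a p] metric_sym[of X "Q Y a"] that by simp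
    then show "tr p (\<lambda>X W. g (Q Y X) a p * g (Q b Z) W p) = - tr p (\<lambda>X W. g (Q Y a) X p * g (Q b Z) W p)"
      unfolding tr_minus[symmetric] by (intro tr_cong) simp
  qed
  also have "\<dots> = tr p (\<lambda>Y Z. tr p (\<lambda>a b. - g (Q Y a) (Q b Z) p))"
  proof (intro tr_cong)
    fix Y Z a b assume [simp]: "Y \<in> VF" "Z \<in> VF" "a \<in> VF" "b \<in> VF"
    have "tr p (\<lambda>X W. g (Q Y a) X p * g (Q b Z) W p) = g (Q b Z) (Q Y a) p"
      by (rule tr_contract[where \<beta> = "\<lambda>W. g (Q b Z) W"]) (simp_all add: tensorial_metric id_tensor)
    then show "- tr p (\<lambda>X W. g (Q Y a) X p * g (Q b Z) W p) = - g (Q Y a) (Q b Z) p"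
      using metric_sym[of "Q b Z" "Q Y a"] by simp
  qed
  also have "\<dots> = - tr p (\<lambda>X W. tr p (\<lambda>a b. g (Q X a) (Q b W) p))"
    by (simp add: tr_minus)
  also have "tr p (\<lambda>X W. tr p (\<lambda>a b. g (Q X a) (Q b W) p)) = tr_QQ p" unfolding tr_QQ_def
    by (rule tr_cong) (rule tr_flip)
  finally show ?thesis .
qed

text \<open>All terms of \<open>curvature_difference\<close> in which \<open>Q\<close> or its derivative is contracted in both vector arguments
vanish; skewness brings the second derivative term and \<open>Q X (Q Y Z)\<close> into this form.  The
remaining three each contribute a multiple of \<open>tr_QQ\<close>, with coefficients \<open>-1\<close>, \<open>-1\<close> and \<open>1\<close> in
\<open>\<tau> - \<tau>'\<close>.\<close>
lemma scalar_curvature_difference: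
  "scalar_curvature A g D' p - scalar_curvature A g D p = tr_QQ p"
proof -
  let ?t = "\<lambda>K. tr p (\<lambda>Y Z. tr p (\<lambda>X W. K X Y Z W))"
  have sc: "scalar_curvature A g C p = ?t (\<lambda>X Y Z W. g (curvature C X Y Z) W p)" for C
    unfolding scalar_curvature_def ricci_def contract_eq_metric_trace ..
  have 1: "?t (\<lambda>X Y Z W. g (DQ X Y Z) W p) = 0"
  proof -
    have "?t (\<lambda>X Y Z W. g (DQ X Y Z) W p) = tr p (\<lambda>X W. tr p (\<lambda>Y Z. g (DQ X Y Z) W p))"
      by (rule tr_swap)
    also have "\<dots> = tr p (\<lambda>X W. 0)" by (rule tr_cong) (simp add: tr_DQ)
    finally show ?thesis by (simp add: metric_trace_def)
  qed
  have 2: "?t (\<lambda>X Y Z W. g (DQ Y X Z) W p) = 0"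
  proof -
    have "tr p (\<lambda>X W. g (DQ Y X Z) W p) = 0" if [simp]: "Y \<in> VF" "Z \<in> VF" for Y Z
    proof -
      have "tr p (\<lambda>X W. g (DQ Y X Z) W p) = tr p (\<lambda>X W. - g (DQ Y X W) Z p)"
        by (rule tr_cong) (rule DQ_skew, simp_all)
      then show ?thesis by (simp add: tr_minus tr_DQ)
    qed
    then have "?t (\<lambda>X Y Z W. g (DQ Y X Z) W p) = tr p (\<lambda>Y Z. 0)" by (rule tr_cong)
    then show ?thesis by (simp add: metric_trace_def)
  qed
  have 3: "?t (\<lambda>X Y Z W. g (Q X (Q Y Z)) W p) = 0"
  proof -
    have "tr p (\<lambda>X W. g (Q X (Q Y Z)) W p) = 0" if [simp]: "Y \<in> VF" "Z \<in> VF" for Y Z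
    proof -
      have "tr p (\<lambda>X W. g (Q X (Q Y Z)) W p) = tr p (\<lambda>X W. - g (Q X W) (Q Y Z) p)"
      proof (rule tr_cong)
        fix X W assume [simp]: "X \<in> VF" "W \<in> VF"
        show "g (Q X (Q Y Z)) W p = - g (Q X W) (Q Y Z) p"
          using Q_skew[of X "Q Y Z" W p] metric_sym[of "Q Y Z" "Q X W"] by simp
      qed
      then show ?thesis by (simp add: tr_minus tr_Q)
    qed
    then have "?t (\<lambda>X Y Z W. g (Q X (Q Y Z)) W p) = tr p (\<lambda>Y Z. 0)" by (rule tr_cong)
    then show ?thesis by (simp add: metric_trace_def)
  qed
  have 4: "?t (\<lambda>X Y Z W. g (Q Y (Q X Z)) W p) = - tr_QQ p"
  proof -
    have "?t (\<lambda>X Y Z W. g (Q Y (Q X Z)) W p) = tr p (\<lambda>X W. tr p (\<lambda>Y Z. g (Q Y (Q X Z)) W p))"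
      by (rule tr_swap)
    also have "\<dots> = tr p (\<lambda>X W. tr p (\<lambda>Y Z. - g (Q X Z) (Q Y W) p))"
      by (intro tr_cong) (rule Q_skew, simp_all)
    finally show ?thesis by (simp add: tr_minus tr_QQ_def)
  qed
  have "scalar_curvature A g D p = ?t (\<lambda>X Y Z W. g (curvature D' X Y Z) W p
    - g (DQ X Y Z) W p + g (DQ Y X Z) W p
    - (g (Q (Q X Y) Z) W p - g (Q (Q Y X) Z) W p)
    + (g (Q X (Q Y Z)) W p - g (Q Y (Q X Z)) W p))"
    unfolding sc by (intro tr_cong curvature_difference)
  also have "\<dots> = scalar_curvature A g D' p - tr_QQ p"
    by (simp add: tr_add tr_diff 1 2 3 4 tr_Q_Q_left tr_Q_Q_right sc)
  finally show ?thesis by simp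
qed

section \<open>The square norm of the derivative of P\<close>

lemma tr_adjoint_metric:
  assumes "tensor_field_1_1 A L" "tensor_field_1_1 A L'" "tensor_field_1_1 A K"
    and "\<And>X Y. X \<in> VF \<Longrightarrow> Y \<in> VF \<Longrightarrow> g (K X) Y = g X (K Y)"
  shows "tr p (\<lambda>X Y. g (L (K X)) (L' Y) p) = tr p (\<lambda>X Y. g (L X) (L' (K Y)) p)"
proof (rule tr_adjoint[OF assms(3,4)])
  fix Y assume Y: "Y \<in> VF"
  have L: "L Y \<in> VF" "L' Y \<in> VF" using assms(1,2) Y unfolding tensor_field_1_1_def by simp_all
  show "tensorial A (\<lambda>X. g (L X) (L' Y))" by (rule tensorial_metric(1)[OF assms(1) L(2)])
  show "tensorial A (\<lambda>X. g (L Y) (L' X))" by (rule tensorial_metric(2)[OF assms(2) L(1)])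
qed

lemmas tr_P_shift = tr_adjoint_metric[OF _ _ P_tensor P_self_adjoint]

abbreviation tr2 :: "'m \<Rightarrow> ('m vfield \<Rightarrow> 'm vfield \<Rightarrow> 'm vfield \<Rightarrow> 'm vfield \<Rightarrow> real) \<Rightarrow> real" where
  "tr2 p K \<equiv> tr p (\<lambda>X X'. tr p (\<lambda>Y Y'. K X X' Y Y'))"

lemma tr2_cong:
  "(\<And>X X' Y Y'. X \<in> VF \<Longrightarrow> X' \<in> VF \<Longrightarrow> Y \<in> VF \<Longrightarrow> Y' \<in> VF \<Longrightarrow> K X X' Y Y' = K' X X' Y Y') \<Longrightarrow>
   tr2 p K = tr2 p K'"
  by (intro tr_cong)

lemma tr2_swap: "tr2 p K = tr2 p (\<lambda>X X' Y Y'. K Y Y' X X')"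
  by (rule tr_swap)

lemma tr2_flip: "tr2 p K = tr2 p (\<lambda>X X' Y Y'. K X' X Y' Y)"
proof -
  have "tr2 p K = tr p (\<lambda>X X'. tr p (\<lambda>Y Y'. K X' X Y Y'))"
    by (rule tr_flip[symmetric])
  also have "\<dots> = tr2 p (\<lambda>X X' Y Y'. K X' X Y' Y)" by (rule tr_cong) (rule tr_flip[symmetric])
  finally show ?thesis .
qed

definition norm_dP :: "'m \<Rightarrow> real" where
  "norm_dP p = tr2 p (\<lambda>X X' Y Y'. g (dP X Y) (dP X' Y') p)"

text \<open>In an orthonormal basis, \<open>\<Sum> g (dP e\<^sub>i e\<^sub>k) (dP e\<^sub>k e\<^sub>i)\<close>.\<close>
definition cross_dP :: "'m \<Rightarrow> real" where
  "cross_dP p = tr2 p (\<lambda>X X' Y Y'. g (dP X Y) (dP Y' X') p)"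

lemma norm_dP_eq: "square_norm_deriv_P A g D P p = norm_dP p"
  unfolding square_norm_deriv_P_def contract_eq_metric_trace norm_dP_def dP_def ..

text \<open>For fixed \<open>X\<close> and \<open>X'\<close>, both \<open>dP X\<close> and \<open>dP (P X')\<close> are self-adjoint and anticommute with \<open>P\<close>.
Hence the trace of \<open>dP X\<close> composed with \<open>P\<close> and \<open>dP (P X')\<close> is minus itself.\<close>
lemma twisted_dP_zero: "tr2 p (\<lambda>X X' Y Y'. g (dP X Y) (P (dP (P X') Y')) p) = 0" (is "?c = 0")
proof -
  have "tr p (\<lambda>Y Y'. g (dP X Y) (P (dP (P X') Y')) p) = - tr p (\<lambda>Y Y'. g (dP X Y) (P (dP (P X') Y')) p)"
    if [simp]: "X \<in> VF" "X' \<in> VF" for X X'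
  proof -
    have "tr p (\<lambda>Y Y'. g (dP X Y) (P (dP (P X') Y')) p) = tr p (\<lambda>Y Y'. g (P (dP X Y)) (dP (P X') Y') p)"
      by (rule tr_cong) (simp add: P_self_adjoint)
    also have "\<dots> = tr p (\<lambda>Y Y'. g (P (dP X (dP (P X') Y))) Y' p)"
      by (rule tr_adjoint_metric[where L' = "\<lambda>X. X" and L = "\<lambda>Y. P (dP X Y)", symmetric])
        (simp_all add: tensor_comp P_tensor dP_tensor id_tensor fun_eq_iff dP_self_adjoint)
    also have "\<dots> = tr p (\<lambda>Y Y'. - g (dP X Y') (P (dP (P X') Y)) p)"
    proof (rule tr_cong)
      fix Y Y' assume [simp]: "Y \<in> VF" "Y' \<in> VF"
      have "g (P (dP X (dP (P X') Y))) Y' p = g (dP X (dP (P X') Y)) (P Y') p" by (simp add: P_self_adjoint)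
      also have "\<dots> = g (dP X (P Y')) (dP (P X') Y) p"
        using metric_sym[of "dP X (P Y')" "dP (P X') Y"] by (simp add: dP_self_adjoint)
      also have "\<dots> = - g (dP X Y') (P (dP (P X') Y)) p" by (simp add: dP_P)
      finally show "g (P (dP X (dP (P X') Y))) Y' p = - g (dP X Y') (P (dP (P X') Y)) p" .
    qed
    also have "\<dots> = - tr p (\<lambda>Y Y'. g (dP X Y) (P (dP (P X') Y')) p)"
      unfolding tr_minus by (subst tr_flip) (rule refl)
    finally show ?thesis .
  qed
  then have "?c = tr p (\<lambda>X X'. - tr p (\<lambda>Y Y'. g (dP X Y) (P (dP (P X') Y')) p))"
    by (rule tr_cong)
  then show ?thesis by (simp add: tr_minus)
qed

text \<open>Shift \<open>P\<close> from \<open>X'\<close> to \<open>X\<close>, where it comes out of \<open>dP Y (P X)\<close> as \<open>- P\<close> and cancels against the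
other \<open>P\<close>.\<close>
lemma cross_dP_twisted: "tr2 p (\<lambda>X X' Y Y'. g (dP Y X) (P (dP (P X') Y')) p) = - cross_dP p"
proof -
  have "tr2 p (\<lambda>X X' Y Y'. g (dP Y X) (P (dP (P X') Y')) p) =
      tr p (\<lambda>Y Y'. tr p (\<lambda>X X'. g (dP Y X) (P (dP (P X') Y')) p))" by (rule tr_swap)
  also have "\<dots> = tr p (\<lambda>Y Y'. tr p (\<lambda>X X'. g (dP Y (P X)) (P (dP X' Y')) p))"
  proof (rule tr_cong)
    fix Y Y' assume [simp]: "Y \<in> VF" "Y' \<in> VF"
    show "tr p (\<lambda>X X'. g (dP Y X) (P (dP (P X') Y')) p) = tr p (\<lambda>X X'. g (dP Y (P X)) (P (dP X' Y')) p)"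
      by (rule tr_P_shift[where L = "dP Y" and L' = "\<lambda>X. P (dP X Y')", symmetric])
        (simp_all add: tensor_comp[OF P_tensor] dP_tensor)
  qed
  also have "\<dots> = tr2 p (\<lambda>X X' Y Y'. - g (dP X Y) (dP Y' X') p)"
    by (rule tr2_cong) (simp add: dP_P)
  also have "\<dots> = - cross_dP p" by (simp add: tr_minus cross_dP_def)
  finally show ?thesis .
qed

text \<open>Contract \<open>W3_sym\<close> with \<open>dP X Y\<close>.  The left-hand side becomes \<open>norm_dP + cross_dP\<close>; of the two terms on the
right-hand side, the first vanishes by \<open>twisted_dP_zero\<close> and the second is \<open>- cross_dP\<close> by \<open>cross_dP_twisted\<close>.\<close>
lemma cross_dP_eq: "2 * cross_dP p = - norm_dP p"
proof -
  have "tr2 p (\<lambda>X X' Y Y'. g (dP X Y) (dP X' Y') p + g (dP X Y) (dP Y' X') p) =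
    tr2 p (\<lambda>X X' Y Y'. g (dP X Y) (P (dP (P X') Y')) p + g (dP X Y) (P (dP (P Y') X')) p)"
  proof (rule tr2_cong)
    fix X X' Y Y' assume [simp]: "X \<in> VF" "X' \<in> VF" "Y \<in> VF" "Y' \<in> VF"
    show "g (dP X Y) (dP X' Y') p + g (dP X Y) (dP Y' X') p =
        g (dP X Y) (P (dP (P X') Y')) p + g (dP X Y) (P (dP (P Y') X')) p"
      using W3_sym[of X' Y' "dP X Y" p]
        P_self_adjoint[of "dP (P X') Y'" "dP X Y"] P_self_adjoint[of "dP (P Y') X'" "dP X Y"]
        metric_sym[of "dP X Y" "P (dP (P X') Y')"] metric_sym[of "dP X Y" "P (dP (P Y') X')"]
        metric_sym[of "dP X Y" "dP X' Y'"] metric_sym[of "dP X Y" "dP Y' X'"] by simp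
  qed
  moreover have "tr2 p (\<lambda>X X' Y Y'. g (dP X Y) (P (dP (P Y') X')) p) = - cross_dP p"
    unfolding cross_dP_twisted[symmetric] by (rule tr_swap)
  ultimately show ?thesis using twisted_dP_zero by (simp add: tr_add norm_dP_def cross_dP_def)
qed

text \<open>Inserting \<open>Q_formula\<close> in both factors gives nine contractions of \<open>dP\<close> with itself.  Two of them are
\<open>norm_dP\<close>, two vanish, and the other five are \<open>\<plusminus> cross_dP\<close>; they add up to
\<open>norm_dP / 4 + cross_dP / 4\<close>.\<close>
lemma tr_QQ_eq: "8 * tr_QQ p = norm_dP p"
proof -
  have 4: "tr2 p (\<lambda>X X' Y Y'. g (dP Y X) (dP Y' X') p) = norm_dP p"
    unfolding norm_dP_def by (rule tr_swap)
  have 5: "tr2 p (\<lambda>X X' Y Y'. g (dP Y X) (dP X' Y') p) = cross_dP p"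
    unfolding cross_dP_def by (rule tr_swap)
  have swapped: "tr2 p (\<lambda>X X' Y Y'. g (dP X Y) (P (dP (P Y') X')) p) = - cross_dP p"
    unfolding cross_dP_twisted[symmetric] by (rule tr_swap)
  have 7: "tr2 p (\<lambda>X X' Y Y'. g (dP Y' X') (P (dP (P Y) X)) p) = 0"
    using twisted_dP_zero[of p] by (subst tr2_flip, subst tr2_swap)
  have 8: "tr2 p (\<lambda>X X' Y Y'. g (dP X' Y') (P (dP (P Y) X)) p) = - cross_dP p"
    using swapped by (subst tr2_flip)
  have 9: "tr2 p (\<lambda>X X' Y Y'. g (dP (P Y) X) (dP (P X') Y') p) = cross_dP p"
  proof -
    have "tr2 p (\<lambda>X X' Y Y'. g (dP (P Y) X) (dP (P X') Y') p) =
        tr p (\<lambda>Y Y'. tr p (\<lambda>X X'. g (dP (P Y) X) (dP (P X') Y') p))" by (rule tr_swap)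
    also have "\<dots> = tr p (\<lambda>Y Y'. tr p (\<lambda>X X'. g (dP (P Y) (P X)) (dP X' Y') p))"
    proof (rule tr_cong)
      fix Y Y' assume [simp]: "Y \<in> VF" "Y' \<in> VF"
      show "tr p (\<lambda>X X'. g (dP (P Y) X) (dP (P X') Y') p) = tr p (\<lambda>X X'. g (dP (P Y) (P X)) (dP X' Y') p)"
        by (rule tr_P_shift[where L = "dP (P Y)" and L' = "\<lambda>X. dP X Y'", symmetric])
          (simp_all add: dP_tensor)
    qed
    also have "\<dots> = tr p (\<lambda>X X'. tr p (\<lambda>Y Y'. g (dP (P Y) (P X)) (dP X' Y') p))"
      by (rule tr_swap)
    also have "\<dots> = tr p (\<lambda>X X'. tr p (\<lambda>Y Y'. g (dP Y (P X)) (dP X' (P Y')) p))"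
    proof (rule tr_cong)
      fix X X' assume [simp]: "X \<in> VF" "X' \<in> VF"
      show "tr p (\<lambda>Y Y'. g (dP (P Y) (P X)) (dP X' Y') p) = tr p (\<lambda>Y Y'. g (dP Y (P X)) (dP X' (P Y')) p)"
        by (rule tr_P_shift[where L = "\<lambda>Y. dP Y (P X)" and L' = "dP X'"])
          (simp_all add: dP_tensor)
    qed
    also have "\<dots> = tr2 p (\<lambda>X X' Y Y'. g (dP Y X) (dP X' Y') p)"
    proof (rule tr2_cong)
      fix X X' Y Y' assume [simp]: "X \<in> VF" "X' \<in> VF" "Y \<in> VF" "Y' \<in> VF"
      have "g (dP Y (P X)) (dP X' (P Y')) p = - g (P (dP Y X)) (dP X' (P Y')) p"
        by (simp add: dP_P P_self_adjoint)
      also have "\<dots> = - g (dP X' (P Y')) (P (dP Y X)) p"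
        using metric_sym[of "P (dP Y X)" "dP X' (P Y')"] by simp
      also have "\<dots> = g (dP Y X) (dP X' Y') p"
        using metric_sym[of "dP Y X" "dP X' Y'"] by (simp add: dP_P)
      finally show "g (dP Y (P X)) (dP X' (P Y')) p = g (dP Y X) (dP X' Y') p" .
    qed
    finally show ?thesis using 5 by simp
  qed
  have "tr_QQ p = tr2 p (\<lambda>X X' Y Y'. g (Q X Y) (Q Y' X') p)"
    unfolding tr_QQ_def by (rule tr_cong) (rule tr_flip)
  also have "\<dots> = tr2 p (\<lambda>X X' Y Y'.
      1/4 * g (dP X Y) (dP Y' X') p + 1/8 * g (dP X Y) (dP X' Y') p + 1/8 * g (dP X Y) (P (dP (P X') Y')) p
      + 1/8 * g (dP Y X) (dP Y' X') p + 1/16 * g (dP Y X) (dP X' Y') p + 1/16 * g (dP Y X) (P (dP (P X') Y')) p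
      + 1/8 * g (dP Y' X') (P (dP (P Y) X)) p + 1/16 * g (dP X' Y') (P (dP (P Y) X)) p
      + 1/16 * g (dP (P Y) X) (dP (P X') Y') p)"
  proof (rule tr2_cong)
    fix X X' Y Y' assume V [simp]: "X \<in> VF" "X' \<in> VF" "Y \<in> VF" "Y' \<in> VF"
    have r: "g U (Q Y' X') p = 1/2 * g (P U) (dP Y' X') p + 1/4 * (g (P U) (dP X' Y') p + g U (dP (P X') Y') p)"
      if [simp]: "U \<in> VF" for U
      using Q_formula[OF V(4,2), of U p] metric_sym[of U "Q Y' X'"] metric_sym[of "P U" "dP Y' X'"]
        metric_sym[of "P U" "dP X' Y'"] metric_sym[of U "dP (P X') Y'"]
      by simp
    have s: "g (P (dP (P Y) X)) (dP Y' X') p = g (dP Y' X') (P (dP (P Y) X)) p"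
      "g (P (dP (P Y) X)) (dP X' Y') p = g (dP X' Y') (P (dP (P Y) X)) p"
      using metric_sym[of "P (dP (P Y) X)" "dP Y' X'"] metric_sym[of "P (dP (P Y) X)" "dP X' Y'"] by simp_all
    have "g (Q X Y) (Q Y' X') p = 1/2 * g (P (dP X Y)) (Q Y' X') p
      + 1/4 * (g (P (dP Y X)) (Q Y' X') p + g (dP (P Y) X) (Q Y' X') p)"
      by (simp add: Q_formula[of X Y "Q Y' X'"] P_self_adjoint)
    then show "g (Q X Y) (Q Y' X') p =
      1/4 * g (dP X Y) (dP Y' X') p + 1/8 * g (dP X Y) (dP X' Y') p + 1/8 * g (dP X Y) (P (dP (P X') Y')) p
      + 1/8 * g (dP Y X) (dP Y' X') p + 1/16 * g (dP Y X) (dP X' Y') p + 1/16 * g (dP Y X) (P (dP (P X') Y')) p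
      + 1/8 * g (dP Y' X') (P (dP (P Y) X)) p + 1/16 * g (dP X' Y') (P (dP (P Y) X)) p
      + 1/16 * g (dP (P Y) X) (dP (P X') Y') p"
      using r[of "P (dP X Y)"] r[of "P (dP Y X)"] r[of "dP (P Y) X"] s
        P_self_adjoint[of "dP X Y" "dP (P X') Y'"] P_self_adjoint[of "dP Y X" "dP (P X') Y'"]
      by simp argo
  qed
  also have "\<dots> = 1/4 * cross_dP p + 1/8 * norm_dP p + 1/8 * norm_dP p + 1/16 * cross_dP p - 1/16 * cross_dP p
      - 1/16 * cross_dP p + 1/16 * cross_dP p"
    unfolding tr_add tr_mult 4 5 7 8 9 cross_dP_twisted twisted_dP_zero
    unfolding norm_dP_def[symmetric] cross_dP_def[symmetric] by simp
  finally show ?thesis using cross_dP_eq[of p] by simp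
qed

lemma square_norm_eq: "square_norm_deriv_P A g D P p =
    8 * (scalar_curvature A g D' p - scalar_curvature A g D p)"
  by (simp add: norm_dP_eq scalar_curvature_difference tr_QQ_eq)

end

theorem theorem4p3:
  fixes A :: "('m::{t2_space, second_countable_topology}, 'n::finite) atlas"
    and P :: "'m vfield \<Rightarrow> 'm vfield"
    and g :: "'m vfield \<Rightarrow> 'm vfield \<Rightarrow> 'm \<Rightarrow> real"
    and D D' :: "'m connection"
  assumes "W3_manifold A P g"
    and "levi_civita A g D"
    and "canonical_connection A P g D'"
  shows "\<forall>p. square_norm_deriv_P A g D P p =
           8 * (scalar_curvature A g D' p - scalar_curvature A g D p)"
proof
  fix p
  have product: "riemannian_almost_product A P g"
    and cyclic: "\<forall>D. levi_civita A g D \<longrightarrow>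
       (\<forall>X\<in>vector_fields A. \<forall>Y\<in>vector_fields A. \<forall>Z\<in>vector_fields A.
          g (deriv_P D P X Y) Z + g (deriv_P D P Y Z) X + g (deriv_P D P Z X) Y = 0)"
    using assms(1) unfolding W3_manifold_def by (rule conjunct1, rule conjunct2)
  interpret W3_canonical A g P D D'
  proof
    show "smooth_manifold A" "riemannian_metric A g" "tensor_field_1_1 A P"
      using product unfolding riemannian_almost_product_def by simp_all
    show "P (P X) = X" if "X \<in> vector_fields A" for X
      using product that unfolding riemannian_almost_product_def by simp
    show "g (P X) (P Y) = g X Y" if "X \<in> vector_fields A" "Y \<in> vector_fields A" for X Y
      using product that unfolding riemannian_almost_product_def by simp
    show "g (deriv_P D P X Y) Z + g (deriv_P D P Y Z) X + g (deriv_P D P Z X) Y = 0"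
      if "X \<in> vector_fields A" "Y \<in> vector_fields A" "Z \<in> vector_fields A" for X Y Z
      using cyclic assms(2) that by blast
  qed (fact assms)+
  show "square_norm_deriv_P A g D P p =
      8 * (scalar_curvature A g D' p - scalar_curvature A g D p)"
    by (rule square_norm_eq)
qed

end
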